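(* Let $n\geq 3$ and let $G$ be a group of order $2^n$. If $G$ is not elementary abelian, then $$\delta(G)\leq \delta\bigl(D_8\times C_2^{\,n-3}\bigr).$$
   Context: For a finite group $G$, $\delta(G)$ denotes the number of all non-cyclic subgroups of $G$ (including $G$ itself if it is non-cyclic). $D_8$ is the dihedral group of order $8$, $C_2$ is the cyclic group of order $2$, and $C_2^{\,d}$ is the direct product of $d$ copies of $C_2$ (trivial if $d=0$). *)

theory Defs
  imports "HOL-Algebra.Algebra"
begin

definition noncyclic_subgroups :: "('a, 'b) monoid_scheme \<Rightarrow> 'a set set" where
  "noncyclic_subgroups G = {H. subgroup H G \<and> \<not> cyclic_group (G\<lparr>carrier := H\<rparr>)}"

definition delta :: "('a, 'b) monoid_scheme \<Rightarrow> nat" where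
  "delta G = card (noncyclic_subgroups G)"

definition elementary_abelian :: "('a, 'b) monoid_scheme \<Rightarrow> bool" where
  "elementary_abelian G \<longleftrightarrow> comm_group G \<and>
     (\<exists>p. Factorial_Ring.prime p \<and> (\<forall>x \<in> carrier G. x \<noteq> \<one>\<^bsub>G\<^esub> \<longrightarrow> group.ord G x = p))"

text \<open>
  The dihedral group of order \<open>2 * m\<close> (so that the group \<open>D\<^sub>8\<close> is \<open>dihedral_group 4\<close>).
  The pair \<open>(i, a)\<close> stands for the element \<open>r\<^sup>i s\<^sup>a\<close>, where \<open>r\<close> is a rotation with
  \<open>r\<^sup>m = 1\<close>, \<open>s\<close> is a reflection, and \<open>s r s = r\<^sup>-\<^sup>1\<close>; hence
  \<open>r\<^sup>i s r\<^sup>j s\<^sup>b = r\<^sup>i\<^sup>-\<^sup>j s\<^sup>1\<^sup>+\<^sup>b\<close>.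
\<close>

definition dihedral_group :: "nat \<Rightarrow> (int \<times> bool) monoid" where
  "dihedral_group m =
     \<lparr>carrier = {0..<int m} \<times> UNIV,
      monoid.mult = (\<lambda>(i, a) (j, b). ((if a then i - j else i + j) mod int m, a \<noteq> b)),
      one = (0, False)\<rparr>"

definition C2_power :: "nat \<Rightarrow> (nat \<Rightarrow> int) monoid" where
  "C2_power d = product_group {..<d} (\<lambda>_. integer_mod_group 2)"

lemma group_dihedral_group:
  assumes "m > 0"
  shows "group (dihedral_group m)"
proof (rule groupI)
  fix x y z
  show "x \<otimes>\<^bsub>dihedral_group m\<^esub> y \<otimes>\<^bsub>dihedral_group m\<^esub> z =
        x \<otimes>\<^bsub>dihedral_group m\<^esub> (y \<otimes>\<^bsub>dihedral_group m\<^esub> z)"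
    by (cases x; cases y; cases z)
      (auto simp: dihedral_group_def mod_simps algebra_simps)
next
  fix x assume "x \<in> carrier (dihedral_group m)"
  then obtain i a where x: "x = (i, a)" "0 \<le> i" "i < int m"
    by (auto simp: dihedral_group_def)
  let ?y = "(if a then i else (- i) mod int m, a)"
  have "?y \<in> carrier (dihedral_group m)"
    "?y \<otimes>\<^bsub>dihedral_group m\<^esub> x = \<one>\<^bsub>dihedral_group m\<^esub>"
    using x assms by (auto simp: dihedral_group_def mod_simps)
  then show "\<exists>y \<in> carrier (dihedral_group m).
      y \<otimes>\<^bsub>dihedral_group m\<^esub> x = \<one>\<^bsub>dihedral_group m\<^esub>"
    by blast
qed (use assms in \<open>auto simp: dihedral_group_def\<close>)

lemma order_dihedral_group: "order (dihedral_group m) = 2 * m"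
  by (simp add: order_def dihedral_group_def card_cartesian_product)

lemma group_C2_power: "group (C2_power d)"
  by (simp add: C2_power_def)

lemma order_C2_power: "order (C2_power d) = 2 ^ d"
  by (simp add: order_def C2_power_def card_PiE carrier_integer_mod_group)

end

theory Submission
  imports Defs
begin

text \<open>
  Among the groups of order \<open>2\<^sup>n\<close> that are not elementary abelian, \<open>D\<^sub>8 \<times> C\<^sub>2\<^bsup>n-3\<^esup>\<close> is reached by two
  comparisons, neither of which decreases the number of noncyclic subgroups.

  The first comparison replaces \<open>G\<close> by \<open>G / {1, z} \<times> C\<^sub>2\<close> for a central involution \<open>z\<close>. Subgroups
  that contain \<open>z\<close> correspond to subgroups of the quotient. Those that avoid \<open>z\<close> are complements of
  \<open>{1, z}\<close> in their product with it, and the complements inside one such product, if there are any, are as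
  many as the homomorphisms from the quotient to \<open>C\<^sub>2\<close>. In the direct product every subgroup above \<open>C\<^sub>2\<close> has
  complements, so there are at least as many subgroups; the resulting injection
  respects noncyclic subgroups (\<open>central_replacement.delta_le\<close>). The replacement is repeated, each time with \<open>z\<close>
  in a normal subgroup that contains all squares and shrinks, until all squares lie in \<open>{1, z}\<close> and
  at least one of them is \<open>z\<close>.

  The second comparison concerns such a group, in which \<open>V = G / {1, z}\<close> is a vector space over the field
  with two elements and squaring is a nonzero quadratic form on it. The subgroups above \<open>z\<close> are the
  subspaces of \<open>V\<close>, and their number depends only on \<open>n\<close>. The cyclic ones among them are \<open>{1, z}\<close> and
  the groups of order four, whose number is governed by the solutions of \<open>x\<^sup>2 = 1\<close>; these make up at most
  three quarters of the group (\<open>card_square_roots_one\<close>). The subgroups that avoid \<open>z\<close> are elementary abelian.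
  They are counted by building ordered bases one vector at a time (\<open>layer_recursion\<close>). A subgroup \<open>H\<close>
  can be extended by the involutions in its centralizer. These are at most half of the group
  unless \<open>H\<close> is central in a nonabelian group, in which case they are at most three quarters; and
  the central \<open>H\<close> are few, because the center has index at least four. In \<open>D\<^sub>8 \<times> C\<^sub>2\<^bsup>n-3\<^esup>\<close> the solutions
  of \<open>x\<^sup>2 = 1\<close> form two elementary abelian subgroups of index two that meet in the center, so that all
  bounds are equalities (\<open>delta_le_extremal\<close>).
\<close>

section \<open>Counting subgroups by ordered bases\<close>

text \<open>
  The cosets \<open>H\<close> and \<open>x H\<close>. When their union is a subgroup, it is the one generated by \<open>H\<close>
  and \<open>x\<close>.
\<close>

definition adjoin :: "('a, 'b) monoid_scheme \<Rightarrow> 'a \<Rightarrow> 'a set \<Rightarrow> 'a set" where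
  "adjoin G x H = H \<union> (\<lambda>h. x \<otimes>\<^bsub>G\<^esub> h) ` H"

text \<open>
  For a normal subgroup \<open>Z\<close> these are the subgroups \<open>K\<close> between \<open>Z\<close> and \<open>A\<close> such that \<open>K / Z\<close> is an
  elementary abelian 2-group. The bound \<open>A\<close> is an arbitrary set, so that it can exclude elements.
  Three choices are used later, with a central involution \<open>z\<close>: the subgroups that contain \<open>z\<close>, the
  elementary abelian subgroups that avoid \<open>z\<close>, and the central ones among the latter.
\<close>

definition elementary_over :: "('a, 'b) monoid_scheme \<Rightarrow> 'a set \<Rightarrow> 'a set \<Rightarrow> 'a set set" where
  "elementary_over G Z A = {K. subgroup K G \<and> Z \<subseteq> K \<and> K \<subseteq> A \<and> (\<forall>x\<in>K. x \<otimes>\<^bsub>G\<^esub> x \<in> Z)}"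

text \<open>
  The layer \<open>k\<close> consists of the \<open>K\<close> for which \<open>K / Z\<close> has dimension \<open>k\<close> over the field with two
  elements.
\<close>

definition layer :: "('a, 'b) monoid_scheme \<Rightarrow> 'a set \<Rightarrow> 'a set \<Rightarrow> nat \<Rightarrow> 'a set set" where
  "layer G Z A k = {K \<in> elementary_over G Z A. card K = card Z * 2 ^ k}"

definition extenders :: "('a, 'b) monoid_scheme \<Rightarrow> 'a set \<Rightarrow> 'a set \<Rightarrow> 'a set \<Rightarrow> 'a set" where
  "extenders G Z A H = {x \<in> carrier G - H. adjoin G x H \<in> elementary_over G Z A}"

primrec span_over :: "('a, 'b) monoid_scheme \<Rightarrow> 'a set \<Rightarrow> 'a list \<Rightarrow> 'a set" where
  "span_over G Z [] = Z"
| "span_over G Z (x # xs) = adjoin G x (span_over G Z xs)"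

text \<open>
  The frames of length \<open>k\<close> are the ordered bases of \<open>K / Z\<close> for all \<open>K\<close> in layer \<open>k\<close> at once, with
  basis vectors represented by group elements.
\<close>

primrec frames :: "('a, 'b) monoid_scheme \<Rightarrow> 'a set \<Rightarrow> 'a set \<Rightarrow> nat \<Rightarrow> 'a list set" where
  "frames G Z A 0 = {[]}"
| "frames G Z A (Suc k) =
     (\<lambda>(xs, x). x # xs) ` (SIGMA xs:frames G Z A k. extenders G Z A (span_over G Z xs))"

text \<open>
  The number of frames that span a given member of layer \<open>k\<close>, where \<open>b\<close> is the order of \<open>Z\<close>. For
  \<open>b = 1\<close> it is the order of the general linear group of degree \<open>k\<close> over the field with two elements.
\<close>

definition frame_count :: "nat \<Rightarrow> nat \<Rightarrow> nat" where
  "frame_count b k = (\<Prod>i<k. b * 2 ^ k - b * 2 ^ i)"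

lemma frame_count_pos: "b > 0 \<Longrightarrow> frame_count b k > 0"
  unfolding frame_count_def by (intro prod_pos) auto

context group
begin

lemma adjoin_subset:
  assumes "subgroup K G" "H \<subseteq> K" "x \<in> K"
  shows "adjoin G x H \<subseteq> K"
  using assms by (auto simp: adjoin_def subgroup.m_closed)

lemma card_adjoin:
  assumes "finite (carrier G)" "subgroup H G" "x \<in> carrier G" "x \<notin> H"
  shows "card (adjoin G x H) = 2 * card H"
proof -
  have H: "H \<subseteq> carrier G" using assms(2) by (rule subgroup.subset)
  have fin: "finite H" using H assms(1) finite_subset by blast
  have inj: "inj_on (\<lambda>h. x \<otimes> h) H"
    using H assms(3) by (intro inj_onI) (meson l_cancel subsetD)
  have "H \<inter> (\<lambda>h. x \<otimes> h) ` H = {}"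
  proof (rule ccontr)
    assume "\<not> ?thesis"
    then obtain h where h: "h \<in> H" "x \<otimes> h \<in> H" by auto
    have "(x \<otimes> h) \<otimes> inv h \<in> H" using h assms(2) by (meson subgroup_def)
    moreover have "(x \<otimes> h) \<otimes> inv h = x" using h H assms(3) by (auto simp: m_assoc)
    ultimately show False using assms(4) by simp
  qed
  then show ?thesis
    using fin by (simp add: adjoin_def card_Un_disjoint card_image[OF inj])
qed

text \<open>
  The hypothesis makes \<open>x\<close> normalise \<open>H\<close>: from \<open>x h x h\<close> in \<open>H\<close> one gets \<open>x h x\<close> in \<open>H\<close>, and \<open>x\<^sup>2\<close> lies
  in \<open>H\<close> by taking \<open>h = 1\<close>. So \<open>H\<close> has index at most two in the group generated by \<open>H\<close> and \<open>x\<close>.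
\<close>

lemma subgroup_adjoin:
  assumes H: "subgroup H G" and x: "x \<in> carrier G"
    and sq: "\<And>h. h \<in> H \<Longrightarrow> (x \<otimes> h) \<otimes> (x \<otimes> h) \<in> H"
  shows "subgroup (adjoin G x H) G"
proof -
  have HG: "H \<subseteq> carrier G" using H by (rule subgroup.subset)
  note mem = subgroup.mem_carrier[OF H]
  have mc: "a \<otimes> b \<in> H" if "a \<in> H" "b \<in> H" for a b
    using that H by (simp add: subgroup.m_closed)
  have ic: "inv a \<in> H" if "a \<in> H" for a
    using that H by (simp add: subgroup.m_inv_closed)
  have xx: "x \<otimes> x \<in> H" using sq[of \<one>] H x by (simp add: subgroup.one_closed)
  have xhx: "x \<otimes> h \<otimes> x \<in> H" if "h \<in> H" for h
  proof -
    have "((x \<otimes> h) \<otimes> (x \<otimes> h)) \<otimes> inv h \<in> H" using mc[OF sq ic] that by blast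
    moreover have "((x \<otimes> h) \<otimes> (x \<otimes> h)) \<otimes> inv h = x \<otimes> h \<otimes> x"
      using x mem[OF that] by (simp add: m_assoc)
    ultimately show ?thesis by simp
  qed
  have hx: "h \<otimes> x \<in> (\<lambda>h. x \<otimes> h) ` H" if "h \<in> H" for h
  proof -
    have "inv (x \<otimes> x) \<otimes> (x \<otimes> h \<otimes> x) \<in> H" using mc[OF ic[OF xx] xhx[OF that]] .
    moreover have "x \<otimes> (inv (x \<otimes> x) \<otimes> (x \<otimes> h \<otimes> x)) = h \<otimes> x"
      using x mem[OF that] by (simp add: m_assoc[symmetric] inv_mult_group)
    ultimately show ?thesis by (metis imageI)
  qed
  have closed: "a \<otimes> b \<in> adjoin G x H" if ab: "a \<in> adjoin G x H" "b \<in> adjoin G x H" for a b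
  proof -
    consider "a \<in> H" "b \<in> H" | h where "a \<in> H" "h \<in> H" "b = x \<otimes> h"
      | h where "h \<in> H" "a = x \<otimes> h" "b \<in> H"
      | h k where "h \<in> H" "a = x \<otimes> h" "k \<in> H" "b = x \<otimes> k"
      using ab unfolding adjoin_def by blast
    then show ?thesis
    proof cases
      case 1 then show ?thesis by (simp add: adjoin_def mc)
    next
      case 2
      obtain h' where h': "h' \<in> H" "a \<otimes> x = x \<otimes> h'" using hx[OF 2(1)] by auto
      have "a \<otimes> b = x \<otimes> (h' \<otimes> h)"
        using 2 h' x mem by (metis m_assoc)
      then show ?thesis using mc[OF h'(1) 2(2)] by (auto simp: adjoin_def)
    next
      case 3
      then have "a \<otimes> b = x \<otimes> (h \<otimes> b)" using x mem by (simp add: m_assoc)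
      then show ?thesis using mc[OF 3(1,3)] by (auto simp: adjoin_def)
    next
      case 4
      then have "a \<otimes> b = (x \<otimes> h \<otimes> x) \<otimes> k" using x mem by (simp add: m_assoc)
      then show ?thesis using mc[OF xhx[OF 4(1)] 4(3)] by (simp add: adjoin_def)
    qed
  qed
  have sub: "adjoin G x H \<subseteq> carrier G" using HG x by (auto simp: adjoin_def)
  have inH: "H \<subseteq> adjoin G x H" by (simp add: adjoin_def)
  show ?thesis
  proof (rule subgroupI)
    show "adjoin G x H \<subseteq> carrier G" by (rule sub)
    show "adjoin G x H \<noteq> {}" using H inH subgroup.one_closed by fastforce
    show "a \<otimes> b \<in> adjoin G x H" if "a \<in> adjoin G x H" "b \<in> adjoin G x H" for a b
      using closed that .
    fix a assume a: "a \<in> adjoin G x H"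
    have aa: "a \<otimes> a \<in> H" using a mc sq by (auto simp: adjoin_def)
    have aG: "a \<in> carrier G" using a sub by blast
    have "a \<otimes> inv (a \<otimes> a) = inv a" using aG by (simp add: inv_mult_group m_assoc[symmetric])
    then show "inv a \<in> adjoin G x H" using closed[OF a] ic[OF aa] inH by (metis subsetD)
  qed
qed

lemma elementary_overD:
  assumes "K \<in> elementary_over G Z A"
  shows "subgroup K G" "Z \<subseteq> K" "K \<subseteq> A" "\<And>x. x \<in> K \<Longrightarrow> x \<otimes> x \<in> Z" "K \<subseteq> carrier G"
  using assms subgroup.subset unfolding elementary_over_def by auto

lemma elementary_over_downward:
  assumes "K \<in> elementary_over G Z A" "subgroup H G" "Z \<subseteq> H" "H \<subseteq> K"
  shows "H \<in> elementary_over G Z A"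
  using assms unfolding elementary_over_def by auto

lemma adjoin_in_elementary_over:
  assumes K: "K \<in> elementary_over G Z A" and H: "H \<in> elementary_over G Z A" "H \<subseteq> K"
    and x: "x \<in> K"
  shows "adjoin G x H \<in> elementary_over G Z A"
proof (rule elementary_over_downward[OF K])
  note K' = elementary_overD[OF K] and H' = elementary_overD[OF H(1)]
  show "subgroup (adjoin G x H) G"
  proof (rule subgroup_adjoin[OF H'(1)])
    show "x \<in> carrier G" using x K'(5) by blast
    fix h assume "h \<in> H"
    then have "x \<otimes> h \<in> K" using x H(2) K'(1) by (auto simp: subgroup.m_closed)
    then show "(x \<otimes> h) \<otimes> (x \<otimes> h) \<in> H" using K'(4) H'(2) by blast
  qed
  show "Z \<subseteq> adjoin G x H" using H'(2) by (auto simp: adjoin_def)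
  show "adjoin G x H \<subseteq> K" by (rule adjoin_subset[OF K'(1) H(2) x])
qed

context
  fixes Z A
  assumes fin: "finite (carrier G)" and Z: "Z \<in> elementary_over G Z A"
begin

lemma span_frame:
  "xs \<in> frames G Z A k \<Longrightarrow> span_over G Z xs \<in> layer G Z A k"
proof (induction k arbitrary: xs)
  case 0
  then show ?case using Z by (simp add: layer_def)
next
  case (Suc k)
  then obtain ys x where ys: "xs = x # ys" "ys \<in> frames G Z A k"
    and x: "x \<in> extenders G Z A (span_over G Z ys)" by auto
  have L: "span_over G Z ys \<in> layer G Z A k" using Suc.IH ys(2) .
  then have "card (adjoin G x (span_over G Z ys)) = 2 * card (span_over G Z ys)"
    using x by (intro card_adjoin fin) (auto simp: layer_def extenders_def elementary_overD)
  then show ?case using L x ys by (auto simp: layer_def extenders_def)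
qed

lemma finite_frames: "finite (frames G Z A k)"
proof (induction k)
  case (Suc k)
  have "finite (extenders G Z A H)" for H using fin by (auto simp: extenders_def)
  then show ?case using Suc by auto
qed auto

lemma finite_elementary_over: "finite (elementary_over G Z A)"
  by (rule finite_subset[of _ "Pow (carrier G)"]) (use fin elementary_overD(5) in blast)+

lemma finite_layer: "finite (layer G Z A k)"
  using finite_elementary_over by (simp add: layer_def)

text \<open>
  Inside a member \<open>K\<close>, every element outside the current span is an admissible next basis vector,
  because the family is closed under passing to subgroups of \<open>K\<close> above \<open>Z\<close>.
\<close>

lemma card_frames_inside:
  assumes K: "K \<in> elementary_over G Z A"
  shows "card {xs \<in> frames G Z A k. span_over G Z xs \<subseteq> K} = (\<Prod>i<k. card K - card Z * 2 ^ i)"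
proof (induction k)
  case 0
  have "{xs. xs = [] \<and> span_over G Z xs \<subseteq> K} = {[]}" using elementary_overD[OF K] by auto
  then show ?case by simp
next
  case (Suc k)
  note K' = elementary_overD[OF K]
  define F where "F = (\<lambda>k. {xs \<in> frames G Z A k. span_over G Z xs \<subseteq> K})"
  have eq: "F (Suc k) = (\<lambda>(xs, x). x # xs) ` (SIGMA xs:F k. K - span_over G Z xs)"
    (is "_ = _ ` ?R")
  proof (intro equalityI subsetI)
    fix ys assume "ys \<in> F (Suc k)"
    then obtain xs x where ys: "ys = x # xs" "xs \<in> frames G Z A k"
      and x: "x \<in> extenders G Z A (span_over G Z xs)" and sub: "adjoin G x (span_over G Z xs) \<subseteq> K"
      by (auto simp: F_def)
    have "subgroup (span_over G Z xs) G"
      using span_frame[OF ys(2)] by (auto simp: layer_def dest: elementary_overD(1))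
    then have "\<one> \<in> span_over G Z xs" by (rule subgroup.one_closed)
    then have "x \<otimes> \<one> \<in> K" using sub unfolding adjoin_def by blast
    then have "x \<in> K" using x by (simp add: extenders_def)
    then show "ys \<in> (\<lambda>(xs, x). x # xs) ` ?R"
      using ys x sub by (auto simp: F_def extenders_def adjoin_def)
  next
    fix ys assume "ys \<in> (\<lambda>(xs, x). x # xs) ` ?R"
    then obtain xs x where ys: "ys = x # xs" "xs \<in> frames G Z A k" "span_over G Z xs \<subseteq> K"
      "x \<in> K" "x \<notin> span_over G Z xs" by (auto simp: F_def)
    have "span_over G Z xs \<in> elementary_over G Z A" using span_frame[OF ys(2)] by (simp add: layer_def)
    then have "adjoin G x (span_over G Z xs) \<in> elementary_over G Z A"
      using adjoin_in_elementary_over[OF K] ys by blast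
    then show "ys \<in> F (Suc k)"
      using ys K' adjoin_subset[OF K'(1) ys(3,4)] by (force simp: F_def extenders_def)
  qed
  have finF: "finite (F k)" using finite_frames by (simp add: F_def)
  have finK: "finite K" using K'(5) fin finite_subset by blast
  have "card (F (Suc k)) = card ?R"
    unfolding eq by (rule card_image) (auto simp: inj_on_def)
  also have "\<dots> = (\<Sum>xs\<in>F k. card (K - span_over G Z xs))"
    using finF finK by (simp add: card_SigmaI)
  also have "\<dots> = (\<Sum>xs\<in>F k. card K - card Z * 2 ^ k)"
  proof (rule sum.cong[OF refl])
    fix xs assume "xs \<in> F k"
    then have "span_over G Z xs \<subseteq> K" "card (span_over G Z xs) = card Z * 2 ^ k"
      using span_frame by (auto simp: F_def layer_def)
    then show "card (K - span_over G Z xs) = card K - card Z * 2 ^ k"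
      using finK by (simp add: card_Diff_subset finite_subset)
  qed
  finally show ?case using Suc by (simp add: F_def)
qed

lemma card_frames_of:
  assumes K: "K \<in> layer G Z A k"
  shows "card {xs \<in> frames G Z A k. span_over G Z xs = K} = frame_count (card Z) k"
proof -
  have K': "K \<in> elementary_over G Z A" "card K = card Z * 2 ^ k" using K by (auto simp: layer_def)
  have finK: "finite K" using elementary_overD(5)[OF K'(1)] fin finite_subset by blast
  have "{xs \<in> frames G Z A k. span_over G Z xs = K} = {xs \<in> frames G Z A k. span_over G Z xs \<subseteq> K}"
    using span_frame K'(2) card_subset_eq[OF finK] by (auto simp: layer_def)
  then show ?thesis using card_frames_inside[OF K'(1), of k] K'(2) by (simp add: frame_count_def)
qed

lemma sum_over_frames:
  "(\<Sum>xs\<in>frames G Z A k. f (span_over G Z xs)) = frame_count (card Z) k * (\<Sum>K\<in>layer G Z A k. f K)"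
proof -
  have "(\<Sum>xs\<in>frames G Z A k. f (span_over G Z xs)) =
      (\<Sum>K\<in>layer G Z A k. \<Sum>xs | xs \<in> frames G Z A k \<and> span_over G Z xs = K. f (span_over G Z xs))"
    by (rule sum.group[symmetric]) (use finite_frames finite_layer span_frame in auto)
  also have "\<dots> = (\<Sum>K\<in>layer G Z A k. frame_count (card Z) k * f K)"
    by (rule sum.cong) (auto simp: card_frames_of)
  finally show ?thesis by (simp add: sum_distrib_left)
qed

text \<open>
  Frames of length \<open>k + 1\<close> are counted in two ways: by the member that they span, and by the member
  that the first \<open>k\<close> chosen vectors span together with the last choice. The number of frames per member
  depends only on \<open>k\<close> and the order of \<open>Z\<close>, so two groups can be compared layer by layer by comparing
  the numbers of extenders.
\<close>

lemma layer_recursion: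
  "frame_count (card Z) (Suc k) * card (layer G Z A (Suc k)) =
   frame_count (card Z) k * (\<Sum>K\<in>layer G Z A k. card (extenders G Z A K))"
proof -
  have "card (frames G Z A (Suc k)) = card (SIGMA xs:frames G Z A k. extenders G Z A (span_over G Z xs))"
    unfolding frames.simps by (rule card_image) (auto simp: inj_on_def)
  also have "\<dots> = (\<Sum>xs\<in>frames G Z A k. card (extenders G Z A (span_over G Z xs)))"
    using finite_frames fin by (simp add: card_SigmaI extenders_def)
  also have "\<dots> = frame_count (card Z) k * (\<Sum>K\<in>layer G Z A k. card (extenders G Z A K))"
    by (rule sum_over_frames)
  finally have "card (frames G Z A (Suc k)) = \<dots>" .
  moreover have "card (frames G Z A (Suc k)) = frame_count (card Z) (Suc k) * card (layer G Z A (Suc k))"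
    using sum_over_frames[where f="\<lambda>_. 1" and k="Suc k"] by (simp del: frames.simps)
  ultimately show ?thesis by simp
qed

end

end

section \<open>Centralizers, involutions and cyclic subgroups\<close>

definition centralizer :: "('a, 'b) monoid_scheme \<Rightarrow> 'a set \<Rightarrow> 'a set" where
  "centralizer G S = {x \<in> carrier G. \<forall>s\<in>S. x \<otimes>\<^bsub>G\<^esub> s = s \<otimes>\<^bsub>G\<^esub> x}"

abbreviation center :: "('a, 'b) monoid_scheme \<Rightarrow> 'a set" where
  "center G \<equiv> centralizer G (carrier G)"

definition square_roots :: "('a, 'b) monoid_scheme \<Rightarrow> 'a \<Rightarrow> 'a set" where
  "square_roots G a = {x \<in> carrier G. x \<otimes>\<^bsub>G\<^esub> x = a}"

context group
begin

lemma subgroup_centralizer: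
  assumes "S \<subseteq> carrier G"
  shows "subgroup (centralizer G S) G"
proof (rule subgroupI)
  show "centralizer G S \<noteq> {}" using assms by (force simp: centralizer_def)
  fix a assume a: "a \<in> centralizer G S"
  show "inv a \<in> centralizer G S"
    unfolding centralizer_def
  proof (intro CollectI conjI ballI)
    show "inv a \<in> carrier G" using a by (simp add: centralizer_def)
    fix s assume s: "s \<in> S"
    then have "a \<otimes> s = s \<otimes> a" "s \<in> carrier G" "a \<in> carrier G"
      using a assms by (auto simp: centralizer_def)
    then have "inv a \<otimes> s = inv a \<otimes> (a \<otimes> s) \<otimes> inv a" by (simp add: m_assoc)
    also have "\<dots> = s \<otimes> inv a"
      using \<open>a \<in> carrier G\<close> \<open>s \<in> carrier G\<close> by (simp add: m_assoc[symmetric])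
    finally show "inv a \<otimes> s = s \<otimes> inv a" .
  qed
  fix b assume b: "b \<in> centralizer G S"
  show "a \<otimes> b \<in> centralizer G S"
    unfolding centralizer_def
  proof (intro CollectI conjI ballI)
    show "a \<otimes> b \<in> carrier G" using a b by (simp add: centralizer_def)
    fix s assume s: "s \<in> S"
    have c: "a \<otimes> s = s \<otimes> a" "b \<otimes> s = s \<otimes> b" "s \<in> carrier G" "a \<in> carrier G" "b \<in> carrier G"
      using a b s assms by (auto simp: centralizer_def)
    then show "a \<otimes> b \<otimes> s = s \<otimes> (a \<otimes> b)" by (metis m_assoc)
  qed
qed (auto simp: centralizer_def)

text \<open>
  \<open>H\<close> and a further coset \<open>x H\<close> fit into \<open>K\<close>.
\<close>

lemma card_proper_subgroup:
  assumes fin: "finite (carrier G)" and H: "subgroup H G" and K: "subgroup K G"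
    and sub: "H \<subset> K"
  shows "2 * card H \<le> card K"
proof -
  obtain x where x: "x \<in> K" "x \<notin> H" using sub by blast
  have KG: "K \<subseteq> carrier G" using K by (rule subgroup.subset)
  have "2 * card H = card (adjoin G x H)" using card_adjoin[OF fin H _ x(2)] x KG by auto
  also have "\<dots> \<le> card K"
    using adjoin_subset[OF K _ x(1)] sub KG fin by (intro card_mono) (auto intro: finite_subset)
  finally show ?thesis .
qed

text \<open>
  The centralizer of a noncentral element lies strictly between the center and the group.
\<close>

lemma card_center_nonabelian:
  assumes fin: "finite (carrier G)" and na: "center G \<noteq> carrier G"
  shows "4 * card (center G) \<le> order G"
proof -
  obtain x where x: "x \<in> carrier G" "x \<notin> center G" using na by (auto simp: centralizer_def)
  let ?C = "centralizer G {x}"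
  have C: "subgroup ?C G" by (rule subgroup_centralizer) (use x in auto)
  have Z: "subgroup (center G) G" by (rule subgroup_centralizer) auto
  have "2 * card (center G) \<le> card ?C"
    by (rule card_proper_subgroup[OF fin Z C]) (use x in \<open>auto simp: centralizer_def\<close>)
  moreover have "2 * card ?C \<le> card (carrier G)"
  proof (rule card_proper_subgroup[OF fin C subgroup_self])
    obtain s where "s \<in> carrier G" "x \<otimes> s \<noteq> s \<otimes> x" using x by (auto simp: centralizer_def)
    then have "s \<in> carrier G" "s \<notin> ?C" by (auto simp: centralizer_def)
    then show "?C \<subset> carrier G" by (auto simp: centralizer_def)
  qed
  ultimately show ?thesis by (simp add: order_def)
qed

lemma involutions_commute:
  assumes "x \<in> square_roots G \<one>" "y \<in> square_roots G \<one>" "x \<otimes> y \<in> square_roots G \<one>"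
  shows "x \<otimes> y = y \<otimes> x"
proof -
  have inv: "inv a = a" if "a \<in> square_roots G \<one>" for a
    using that by (simp add: square_roots_def inv_equality)
  have "x \<otimes> y = inv (x \<otimes> y)" using inv[OF assms(3)] by simp
  also have "\<dots> = inv y \<otimes> inv x" using assms by (simp add: square_roots_def inv_mult_group)
  finally show ?thesis using inv assms by simp
qed

lemma subgroup_square_roots_one:
  assumes "\<And>x y. x \<in> square_roots G \<one> \<Longrightarrow> y \<in> square_roots G \<one> \<Longrightarrow> x \<otimes> y = y \<otimes> x"
  shows "subgroup (square_roots G \<one>) G"
proof (rule subgroupI)
  fix x assume x: "x \<in> square_roots G \<one>"
  then have "inv x = x" by (auto simp: square_roots_def inv_equality)
  then show "inv x \<in> square_roots G \<one>" using x by simp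
  fix y assume y: "y \<in> square_roots G \<one>"
  have xG: "x \<in> carrier G" and yG: "y \<in> carrier G" using x y by (auto simp: square_roots_def)
  have "(x \<otimes> y) \<otimes> (x \<otimes> y) = (x \<otimes> y) \<otimes> (y \<otimes> x)" using assms[OF x y] by simp
  also have "\<dots> = x \<otimes> (y \<otimes> y) \<otimes> x"
    using xG yG by (simp add: m_assoc)
  also have "\<dots> = \<one>" using x y by (simp add: square_roots_def)
  finally show "x \<otimes> y \<in> square_roots G \<one>" using x y by (simp add: square_roots_def)
qed (auto simp: square_roots_def)

text \<open>
  If more than three quarters of the elements square to one, then for such an element \<open>x\<close> more than half
  of the elements \<open>s\<close> satisfy that both \<open>s\<close> and \<open>x\<^sup>-\<^sup>1 s\<close> square to one. All of these commute with \<open>x\<close>, so \<open>x\<close> is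
  central. The solutions of \<open>x\<^sup>2 = 1\<close> then form a subgroup with more than half of the elements, hence the
  whole group.
\<close>

lemma card_square_roots_one:
  assumes fin: "finite (carrier G)" and ne: "square_roots G \<one> \<noteq> carrier G"
  shows "4 * card (square_roots G \<one>) \<le> 3 * order G"
proof (rule ccontr)
  let ?I = "square_roots G \<one>"
  assume "\<not> ?thesis"
  then have big: "3 * card (carrier G) < 4 * card ?I" by (simp add: order_def)
  have IG: "?I \<subseteq> carrier G" by (auto simp: square_roots_def)
  have finI: "finite ?I" using IG fin finite_subset by blast
  have central: "x \<otimes> y = y \<otimes> x" if x: "x \<in> ?I" and y: "y \<in> carrier G" for x y
  proof -
    let ?C = "centralizer G {x}"
    have xG: "x \<in> carrier G" using x IG by blast
    let ?S = "?I \<inter> (\<lambda>y. x \<otimes> y) ` ?I"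
    have inj: "inj_on (\<lambda>y. x \<otimes> y) ?I"
      using IG xG by (intro inj_onI) (meson l_cancel subsetD)
    have "card ?I + card ((\<lambda>y. x \<otimes> y) ` ?I) = card (?I \<union> (\<lambda>y. x \<otimes> y) ` ?I) + card ?S"
      by (rule card_Un_Int) (use finI in auto)
    moreover have "card (?I \<union> (\<lambda>y. x \<otimes> y) ` ?I) \<le> card (carrier G)"
      by (rule card_mono) (use IG xG fin in auto)
    ultimately have S: "card (carrier G) < 2 * card ?S"
      using big by (simp add: card_image[OF inj])
    have "?S \<subseteq> ?C"
    proof
      fix s assume s: "s \<in> ?S"
      then obtain y where y: "y \<in> ?I" "s = x \<otimes> y" by blast
      have "x \<otimes> y = y \<otimes> x" using involutions_commute[OF x y(1)] IntD1[OF s] y(2) by simp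
      then have "s \<otimes> x = x \<otimes> s" using y IG xG by (metis m_assoc subsetD)
      then show "s \<in> ?C" using s IG by (auto simp: centralizer_def)
    qed
    then have "card ?S \<le> card ?C"
      by (rule card_mono[rotated]) (use fin in \<open>auto simp: centralizer_def\<close>)
    then have "\<not> 2 * card ?C \<le> card (carrier G)" using S by simp
    moreover have C: "subgroup ?C G" by (rule subgroup_centralizer) (use xG in auto)
    ultimately have "\<not> ?C \<subset> carrier G" using card_proper_subgroup[OF fin C subgroup_self] by blast
    then have "?C = carrier G" using subgroup.subset[OF C] by blast
    then have "y \<in> ?C" using y by simp
    then show ?thesis by (simp add: centralizer_def)
  qed
  have "subgroup ?I G" using central IG by (intro subgroup_square_roots_one) auto
  then have "2 * card ?I \<le> card (carrier G)"
    using card_proper_subgroup[OF fin _ subgroup_self] ne IG by blast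
  then show False using big by simp
qed

lemma cyclic_subgroup_iff:
  assumes fin: "finite (carrier G)" and K: "subgroup K G"
  shows "cyclic_group (G\<lparr>carrier := K\<rparr>) \<longleftrightarrow> (\<exists>x\<in>K. K = range (\<lambda>k::nat. x [^] k))"
proof -
  interpret K: group "G\<lparr>carrier := K\<rparr>" by (rule subgroup.subgroup_is_group[OF K is_group])
  have KG: "K \<subseteq> carrier G" using K by (rule subgroup.subset)
  have "range (\<lambda>k::int. x [^]\<^bsub>G\<lparr>carrier := K\<rparr>\<^esub> k) = range (\<lambda>k::nat. x [^] k)" if x: "x \<in> K" for x
  proof -
    have xG: "x \<in> carrier G" using x KG by blast
    have "range (\<lambda>k::int. x [^]\<^bsub>G\<lparr>carrier := K\<rparr>\<^esub> k) = range (\<lambda>k::int. x [^] k)"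
      using int_pow_consistent[OF K x] by auto
    also have "\<dots> = generate G {x}" using generate_pow[OF xG] by auto
    also have "\<dots> = range (\<lambda>k::nat. x [^] k)" using generate_pow_on_finite_carrier[OF fin xG] by auto
    finally show ?thesis .
  qed
  then show ?thesis unfolding K.cyclic_group by auto
qed

lemma range_pow_involution:
  assumes "x \<in> carrier G" "x \<otimes> x = \<one>"
  shows "range (\<lambda>k::nat. x [^] k) = {\<one>, x}"
proof -
  have "x [^] k \<in> {\<one>, x}" for k :: nat
    by (induction k) (use assms in auto)
  moreover have "\<one> = x [^] (0::nat)" "x = x [^] (1::nat)" using assms by auto
  ultimately show ?thesis by (intro equalityI image_subsetI) blast+
qed

end

locale central_involution = group G for G (structure) +
  fixes z
  assumes fin: "finite (carrier G)"
    and z_central: "z \<in> center G"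
    and z_neq_one: "z \<noteq> \<one>"
    and z_square: "z \<otimes> z = \<one>"
begin

lemma z_closed [simp]: "z \<in> carrier G"
  using z_central by (simp add: centralizer_def)

lemma z_comm: "x \<in> carrier G \<Longrightarrow> z \<otimes> x = x \<otimes> z"
  using z_central by (simp add: centralizer_def)

lemma one_in_elementary_over:
  assumes "subgroup Y G"
  shows "{\<one>} \<in> elementary_over G {\<one>} (Y - {z})"
  using assms z_neq_one subgroup.one_closed[OF assms]
  by (auto simp: elementary_over_def triv_subgroup)

text \<open>
  If \<open>x\<close> extends an elementary abelian subgroup \<open>H\<close> that avoids \<open>z\<close> to another one, then \<open>x\<close> is an
  involution commuting with \<open>H\<close>, and the result avoids \<open>z\<close> exactly when \<open>x\<close> is not in \<open>z H\<close>.
\<close>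

lemma extenders_avoiding:
  assumes Y: "subgroup Y G" "z \<in> Y" and H: "H \<in> elementary_over G {\<one>} (Y - {z})"
  shows "extenders G {\<one>} (Y - {z}) H = Y \<inter> centralizer G H \<inter> square_roots G \<one> - adjoin G z H"
proof (intro equalityI subsetI)
  note H' = elementary_overD[OF H]
  fix x assume "x \<in> extenders G {\<one>} (Y - {z}) H"
  then have x: "x \<in> carrier G" "x \<notin> H" and K: "adjoin G x H \<in> elementary_over G {\<one>} (Y - {z})"
    by (auto simp: extenders_def)
  note K' = elementary_overD[OF K]
  have H1: "\<one> \<in> H" using H'(2) by simp
  have xK: "x \<in> adjoin G x H" using H1 x by (force simp: adjoin_def)
  have KI: "adjoin G x H \<subseteq> square_roots G \<one>" using K'(4,5) by (auto simp: square_roots_def)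
  have "x \<otimes> h = h \<otimes> x" if "h \<in> H" for h
    by (rule involutions_commute) (use that xK KI in \<open>auto simp: adjoin_def\<close>)
  then have "x \<in> centralizer G H" using x by (simp add: centralizer_def)
  moreover have "x \<noteq> z \<otimes> h" if h: "h \<in> H" for h
  proof
    assume "x = z \<otimes> h"
    moreover have "h \<in> square_roots G \<one>" using h KI by (auto simp: adjoin_def)
    ultimately have "x \<otimes> h = z" by (simp add: square_roots_def m_assoc)
    moreover have "x \<otimes> h \<in> adjoin G x H" using h by (simp add: adjoin_def)
    ultimately show False using K'(3) by blast
  qed
  ultimately show "x \<in> Y \<inter> centralizer G H \<inter> square_roots G \<one> - adjoin G z H"
    using x xK KI K'(3) by (auto simp: adjoin_def)
next
  note H' = elementary_overD[OF H]
  fix x assume "x \<in> Y \<inter> centralizer G H \<inter> square_roots G \<one> - adjoin G z H"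
  then have x: "x \<in> carrier G" "x \<in> Y" "x \<otimes> x = \<one>" "\<And>h. h \<in> H \<Longrightarrow> x \<otimes> h = h \<otimes> x"
    "x \<notin> H" "\<And>h. h \<in> H \<Longrightarrow> x \<noteq> z \<otimes> h"
    by (auto simp: adjoin_def centralizer_def square_roots_def)
  have hh: "h \<otimes> h = \<one>" if "h \<in> H" for h using H'(4)[OF that] by simp
  have sq: "(x \<otimes> h) \<otimes> (x \<otimes> h) = \<one>" if h: "h \<in> H" for h
  proof -
    have hG: "h \<in> carrier G" using h H'(5) by blast
    have "(x \<otimes> h) \<otimes> (x \<otimes> h) = (x \<otimes> h) \<otimes> (h \<otimes> x)" using x(4)[OF h] by simp
    also have "\<dots> = x \<otimes> (h \<otimes> h) \<otimes> x" using x hG by (simp add: m_assoc)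
    finally show ?thesis using x hh[OF h] by simp
  qed
  have "subgroup (adjoin G x H) G"
    by (rule subgroup_adjoin[OF H'(1) x(1)]) (use sq H'(2) in simp)
  moreover have "adjoin G x H \<subseteq> Y - {z}"
  proof -
    have "adjoin G x H \<subseteq> Y" using adjoin_subset[OF Y(1) _ x(2)] H'(3) by blast
    moreover have "x \<otimes> h \<noteq> z" if h: "h \<in> H" for h
    proof
      assume "x \<otimes> h = z"
      moreover have hG: "h \<in> carrier G" using h H'(5) by blast
      ultimately have "z \<otimes> h = x" using hh[OF h] x(1) by (metis m_assoc r_one)
      then show False using x(6)[OF h] by simp
    qed
    ultimately show ?thesis using H'(3) by (auto simp: adjoin_def)
  qed
  ultimately have "adjoin G x H \<in> elementary_over G {\<one>} (Y - {z})"
    using sq hh H'(2) by (auto simp: elementary_over_def adjoin_def)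
  then show "x \<in> extenders G {\<one>} (Y - {z}) H" using x by (simp add: extenders_def)
qed

lemma adjoin_z_subset:
  assumes Y: "subgroup Y G" "z \<in> Y" and H: "H \<in> elementary_over G {\<one>} (Y - {z})"
  shows "adjoin G z H \<subseteq> Y \<inter> centralizer G H \<inter> square_roots G \<one>"
proof -
  note H' = elementary_overD[OF H]
  have H1: "\<one> \<in> H" using H'(2) by simp
  have HI: "H \<subseteq> square_roots G \<one>" using H'(4,5) by (auto simp: square_roots_def)
  have HC: "h \<otimes> k = k \<otimes> h" if "h \<in> H" "k \<in> H" for h k
    by (rule involutions_commute) (use that HI H'(1) in \<open>auto simp: subgroup.m_closed\<close>)
  have "h \<in> centralizer G H" if "h \<in> H" for h
    using that HC H'(5) by (auto simp: centralizer_def)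
  moreover have sc: "subgroup (centralizer G H) G" by (rule subgroup_centralizer[OF H'(5)])
  moreover have "z \<in> centralizer G H" using H'(5) z_comm by (auto simp: centralizer_def)
  ultimately have "adjoin G z H \<subseteq> centralizer G H" by (intro adjoin_subset) auto
  moreover have "adjoin G z H \<subseteq> Y" using adjoin_subset[OF Y(1) _ Y(2)] H'(3) by blast
  moreover have "z \<otimes> h \<in> square_roots G \<one>" if h: "h \<in> H" for h
  proof -
    have hG: "h \<in> carrier G" using h H'(5) by blast
    have "(z \<otimes> h) \<otimes> (z \<otimes> h) = (z \<otimes> h) \<otimes> (h \<otimes> z)" using z_comm[OF hG] by simp
    also have "\<dots> = z \<otimes> (h \<otimes> h) \<otimes> z" using hG by (simp add: m_assoc)
    also have "\<dots> = \<one>" using h HI z_square by (auto simp: square_roots_def)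
    finally show ?thesis using hG by (simp add: square_roots_def)
  qed
  ultimately show ?thesis using HI by (auto simp: adjoin_def)
qed

lemma card_extenders_avoiding:
  assumes Y: "subgroup Y G" "z \<in> Y" and H: "H \<in> elementary_over G {\<one>} (Y - {z})"
  shows "card (extenders G {\<one>} (Y - {z}) H) =
    card (Y \<inter> centralizer G H \<inter> square_roots G \<one>) - 2 * card H"
proof -
  note H' = elementary_overD[OF H]
  have "card (adjoin G z H) = 2 * card H"
    by (rule card_adjoin[OF fin H'(1)]) (use H'(3) in auto)
  moreover have "finite (adjoin G z H)"
    using H'(5) fin by (auto simp: adjoin_def intro: finite_subset)
  ultimately show ?thesis
    using adjoin_z_subset[OF assms] by (simp add: extenders_avoiding[OF assms] card_Diff_subset)
qed

lemma subgroup_one_z: "subgroup {\<one>, z} G"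
  by (rule subgroupI) (auto simp: z_square inv_equality)

end

section \<open>Groups whose squares lie in a central subgroup of order two\<close>

text \<open>
  In these groups the quotient by \<open>{1, z}\<close> is elementary abelian, so a subgroup either contains \<open>z\<close> or
  is itself elementary abelian. Both kinds are counted by layers.
\<close>

locale near_elementary_two_group = central_involution +
  fixes n :: nat
  assumes order: "order G = 2 ^ n"
    and n_ge: "2 \<le> n"
    and squares: "x \<in> carrier G \<Longrightarrow> x \<otimes> x \<in> {\<one>, z}"
begin

abbreviation avoiding :: "nat \<Rightarrow> 'a set set" where
  "avoiding k \<equiv> layer G {\<one>} (carrier G - {z}) k"

abbreviation central_avoiding :: "nat \<Rightarrow> 'a set set" where
  "central_avoiding k \<equiv> layer G {\<one>} (center G - {z}) k"

abbreviation containing :: "nat \<Rightarrow> 'a set set" where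
  "containing k \<equiv> layer G {\<one>, z} (carrier G) k"

lemma subgroup_center: "subgroup (center G) G"
  by (rule subgroup_centralizer) simp

lemma card_one_z: "card {\<one>, z} = 2"
  using z_neq_one by auto

lemma avoiding_recursion:
  assumes "subgroup Y G" "z \<in> Y"
  shows "frame_count 1 (Suc k) * card (layer G {\<one>} (Y - {z}) (Suc k)) =
    frame_count 1 k * (\<Sum>H\<in>layer G {\<one>} (Y - {z}) k.
      card (Y \<inter> centralizer G H \<inter> square_roots G \<one>) - 2 * 2 ^ k)"
proof -
  have "(\<Sum>H\<in>layer G {\<one>} (Y - {z}) k. card (extenders G {\<one>} (Y - {z}) H)) =
      (\<Sum>H\<in>layer G {\<one>} (Y - {z}) k. card (Y \<inter> centralizer G H \<inter> square_roots G \<one>) - 2 * 2 ^ k)"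
    by (rule sum.cong) (auto simp: layer_def card_extenders_avoiding[OF assms])
  then show ?thesis
    using layer_recursion[OF fin one_in_elementary_over[OF assms(1)], of k] by simp
qed

lemma finite_avoiding: "finite (layer G {\<one>} (Y - {z}) k)" if "subgroup Y G"
  by (rule finite_layer[OF fin one_in_elementary_over[OF that]])

lemma avoiding_zero: "layer G {\<one>} (Y - {z}) 0 = {{\<one>}}" if "subgroup Y G"
proof -
  have "K = {\<one>}" if "\<one> \<in> K" "card K = 1" for K
    using that by (auto simp: card_1_singleton_iff)
  then show ?thesis
    using one_in_elementary_over[OF that] by (auto simp: layer_def elementary_over_def)
qed

lemma one_z_in_elementary_over: "{\<one>, z} \<in> elementary_over G {\<one>, z} (carrier G)"
  using subgroup_one_z z_square by (auto simp: elementary_over_def)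

text \<open>
  Every element outside a subgroup that contains \<open>z\<close> extends it, so the number of subgroups above \<open>z\<close>
  depends only on the order of the group.
\<close>

lemma containing_recursion:
  "frame_count 2 (Suc k) * card (containing (Suc k)) =
   frame_count 2 k * (card (containing k) * (2 ^ n - 2 * 2 ^ k))"
proof -
  have ext: "card (extenders G {\<one>, z} (carrier G) H) = 2 ^ n - 2 * 2 ^ k" if H: "H \<in> containing k" for H
  proof -
    have H0: "H \<in> elementary_over G {\<one>, z} (carrier G)" and cH: "card H = 2 * 2 ^ k"
      using H card_one_z by (auto simp: layer_def)
    note H' = elementary_overD[OF H0]
    have "adjoin G x H \<in> elementary_over G {\<one>, z} (carrier G)" if x: "x \<in> carrier G" for x
    proof -
      have "subgroup (adjoin G x H) G"
      proof (rule subgroup_adjoin[OF H'(1) x])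
        fix h assume "h \<in> H"
        then have "x \<otimes> h \<in> carrier G" using x H'(5) by blast
        then show "(x \<otimes> h) \<otimes> (x \<otimes> h) \<in> H" using squares H'(2) by blast
      qed
      moreover have "adjoin G x H \<subseteq> carrier G" using H'(5) x by (auto simp: adjoin_def)
      moreover have "{\<one>, z} \<subseteq> adjoin G x H" using H'(2) by (auto simp: adjoin_def)
      ultimately show ?thesis using squares by (simp add: elementary_over_def subset_iff)
    qed
    then have "extenders G {\<one>, z} (carrier G) H = carrier G - H" by (auto simp: extenders_def)
    moreover have "finite H" using H'(5) fin finite_subset by blast
    ultimately show ?thesis using cH H'(5) order by (simp add: card_Diff_subset order_def)
  qed
  show ?thesis using layer_recursion[OF fin one_z_in_elementary_over, of k] ext card_one_z by simp
qed

lemma containing_zero: "containing 0 = {{\<one>, z}}"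
proof -
  have "K = {\<one>, z}" if "K \<in> elementary_over G {\<one>, z} (carrier G)" "card K = 2" for K
  proof -
    have "finite K" using elementary_overD(5)[OF that(1)] fin finite_subset by blast
    then show ?thesis
      using card_subset_eq[of K "{\<one>, z}"] elementary_overD(2)[OF that(1)] that(2) card_one_z by simp
  qed
  then show ?thesis
    using one_z_in_elementary_over card_one_z by (auto simp: layer_def)
qed

lemma card_subgroup_power:
  assumes "subgroup K G"
  obtains j where "j \<le> n" "card K = 2 ^ j"
proof -
  have "card K dvd 2 ^ n" using lagrange[OF assms] order by (metis dvd_triv_right)
  then show ?thesis using that divides_primepow_nat[of 2 "card K" n] by auto
qed

text \<open>
  An elementary abelian 2-group is cyclic exactly when its order is at most two, which removes the layers
  \<open>0\<close> and \<open>1\<close>.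
\<close>

lemma noncyclic_avoiding:
  "{K \<in> noncyclic_subgroups G. z \<notin> K} = (\<Union>k\<in>{2..n}. avoiding k)"
proof (intro equalityI subsetI)
  fix K assume "K \<in> {K \<in> noncyclic_subgroups G. z \<notin> K}"
  then have K: "subgroup K G" "\<not> cyclic_group (G\<lparr>carrier := K\<rparr>)" "z \<notin> K"
    by (auto simp: noncyclic_subgroups_def)
  have KG: "K \<subseteq> carrier G" using K(1) by (rule subgroup.subset)
  have "x \<otimes> x = \<one>" if "x \<in> K" for x
    using squares[of x] that KG K(3) subgroup.m_closed[OF K(1) that that] by auto
  then have el: "K \<in> elementary_over G {\<one>} (carrier G - {z})"
    using K KG subgroup.one_closed[OF K(1)] by (auto simp: elementary_over_def)
  obtain j where j: "j \<le> n" "card K = 2 ^ j" using card_subgroup_power[OF K(1)] .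
  have "2 \<le> j"
  proof (rule ccontr)
    assume "\<not> 2 \<le> j"
    then have "j = 0 \<or> j = 1" by auto
    then have c: "card K \<le> 2" using j by auto
    have oK: "\<one> \<in> K" by (rule subgroup.one_closed[OF K(1)])
    have finK: "finite K" using KG fin finite_subset by blast
    obtain x where x: "x \<in> K" "K = {\<one>, x}"
    proof (cases "K = {\<one>}")
      case True
      then show ?thesis using that[of \<one>] by auto
    next
      case False
      then obtain x where x: "x \<in> K" "x \<noteq> \<one>" using oK by auto
      then have "{\<one>, x} = K" using oK c by (intro card_seteq finK) auto
      then show ?thesis using that x by auto
    qed
    then have "K = range (\<lambda>k::nat. x [^] k)"
      using range_pow_involution[of x] KG \<open>\<And>x. x \<in> K \<Longrightarrow> x \<otimes> x = \<one>\<close> by auto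
    then show False using K(2) cyclic_subgroup_iff[OF fin K(1)] x(1) by blast
  qed
  then show "K \<in> (\<Union>k\<in>{2..n}. avoiding k)" using el j by (auto simp: layer_def)
next
  fix K assume "K \<in> (\<Union>k\<in>{2..n}. avoiding k)"
  then obtain k where k: "2 \<le> k" and el: "K \<in> elementary_over G {\<one>} (carrier G - {z})"
    and c: "card K = 2 ^ k" by (auto simp: layer_def)
  note K = elementary_overD[OF el]
  have "\<not> cyclic_group (G\<lparr>carrier := K\<rparr>)"
  proof
    assume "cyclic_group (G\<lparr>carrier := K\<rparr>)"
    then obtain x where "x \<in> K" "K = range (\<lambda>k::nat. x [^] k)"
      using cyclic_subgroup_iff[OF fin K(1)] by blast
    then have "K = {\<one>, x}" using range_pow_involution[of x] K(4,5) by auto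
    then have "card K \<le> 2" by (simp add: card_insert_if)
    moreover have "(2::nat) ^ 2 \<le> 2 ^ k" using k by (intro power_increasing) auto
    ultimately show False using c by simp
  qed
  then show "K \<in> {K \<in> noncyclic_subgroups G. z \<notin> K}"
    using K by (auto simp: noncyclic_subgroups_def)
qed

lemma subgroups_containing:
  "{K. subgroup K G \<and> z \<in> K} = (\<Union>k\<in>{..n}. containing k)"
proof (intro equalityI subsetI)
  fix K assume "K \<in> {K. subgroup K G \<and> z \<in> K}"
  then have K: "subgroup K G" "z \<in> K" by auto
  have KG: "K \<subseteq> carrier G" using K(1) by (rule subgroup.subset)
  have oK: "\<one> \<in> K" by (rule subgroup.one_closed[OF K(1)])
  have el: "K \<in> elementary_over G {\<one>, z} (carrier G)"
    using K KG oK squares by (simp add: elementary_over_def subset_iff)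
  obtain j where j: "j \<le> n" "card K = 2 ^ j" using card_subgroup_power[OF K(1)] .
  have "card {\<one>, z} \<le> card K"
    using K oK KG fin by (intro card_mono) (auto intro: finite_subset)
  then have "j \<noteq> 0" using j card_one_z by (intro notI) simp
  then obtain i where "j = Suc i" using not0_implies_Suc by blast
  then show "K \<in> (\<Union>k\<in>{..n}. containing k)"
    using el j card_one_z by (auto simp: layer_def)
qed (auto simp: layer_def dest: elementary_overD)

text \<open>
  Since \<open>x\<^sup>2\<close> is \<open>1\<close> or \<open>z\<close>, a cyclic subgroup has order at most four; if it contains \<open>z\<close> it is
  generated by \<open>z\<close> or by a square root of \<open>z\<close>.
\<close>

lemma cyclic_containing:
  "{K. subgroup K G \<and> z \<in> K \<and> cyclic_group (G\<lparr>carrier := K\<rparr>)} =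
   insert {\<one>, z} ((\<lambda>x. {\<one>, x, z, x \<otimes> z}) ` square_roots G z)"
proof -
  have pow: "range (\<lambda>k::nat. x [^] k) = {\<one>, x, z, x \<otimes> z}" if x: "x \<in> square_roots G z" for x
  proof -
    have xG: "x \<in> carrier G" and xx: "x \<otimes> x = z" using x by (auto simp: square_roots_def)
    have "x [^] k \<in> {\<one>, x, z, x \<otimes> z}" for k :: nat
    proof (induction k)
      case (Suc k)
      have "x \<otimes> z \<otimes> x = z \<otimes> x \<otimes> x" using z_comm[OF xG] by simp
      also have "\<dots> = z \<otimes> (x \<otimes> x)" using xG by (simp only: m_assoc z_closed)
      finally have "x \<otimes> z \<otimes> x = \<one>" using xx z_square by simp
      then have "y \<otimes> x \<in> {\<one>, x, z, x \<otimes> z}" if "y \<in> {\<one>, x, z, x \<otimes> z}" for y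
        using that xx z_comm[OF xG] l_one[OF xG] by (elim insertE emptyE) simp_all
      from this[OF Suc] show ?case by (simp only: nat_pow_Suc)
    qed simp
    moreover have "x [^] (0::nat) = \<one>" "x [^] (1::nat) = x" "x [^] (2::nat) = z" "x [^] (3::nat) = x \<otimes> z"
      using xG by (simp_all add: numeral_2_eq_2 numeral_3_eq_3 xx z_comm)
    then have "\<one> \<in> range (\<lambda>k::nat. x [^] k)" "x \<in> range (\<lambda>k::nat. x [^] k)"
      "z \<in> range (\<lambda>k::nat. x [^] k)" "x \<otimes> z \<in> range (\<lambda>k::nat. x [^] k)"
      by (metis rangeI)+
    ultimately show ?thesis by (intro equalityI image_subsetI) (assumption | simp)+
  qed
  show ?thesis
  proof (intro equalityI subsetI)
    fix K assume "K \<in> {K. subgroup K G \<and> z \<in> K \<and> cyclic_group (G\<lparr>carrier := K\<rparr>)}"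
    then have K: "subgroup K G" "z \<in> K" "cyclic_group (G\<lparr>carrier := K\<rparr>)" by auto
    then obtain x where x: "x \<in> K" "K = range (\<lambda>k::nat. x [^] k)"
      using cyclic_subgroup_iff[OF fin K(1)] by blast
    have xG: "x \<in> carrier G" by (rule subgroup.mem_carrier[OF K(1) x(1)])
    show "K \<in> insert {\<one>, z} ((\<lambda>x. {\<one>, x, z, x \<otimes> z}) ` square_roots G z)"
    proof (cases "x \<otimes> x = \<one>")
      case True
      then have "K = {\<one>, x}" using x(2) range_pow_involution[OF xG] by simp
      then have "z = x" using K(2) z_neq_one by simp
      then show ?thesis using \<open>K = {\<one>, x}\<close> by simp
    next
      case False
      then have "x \<otimes> x = z" using squares[OF xG] by blast
      then have r: "x \<in> square_roots G z" using xG by (simp add: square_roots_def)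
      then show ?thesis unfolding x(2) pow[OF r] by blast
    qed
  next
    fix K assume "K \<in> insert {\<one>, z} ((\<lambda>x. {\<one>, x, z, x \<otimes> z}) ` square_roots G z)"
    then obtain x where x: "x \<in> carrier G" "x \<in> K" "z \<in> K" "K = range (\<lambda>k::nat. x [^] k)"
    proof (elim insertE)
      assume "K = {\<one>, z}"
      then show ?thesis using that[of z] range_pow_involution[OF z_closed z_square] z_closed by simp
    next
      assume "K \<in> (\<lambda>x. {\<one>, x, z, x \<otimes> z}) ` square_roots G z"
      then obtain x where x: "x \<in> square_roots G z" "K = {\<one>, x, z, x \<otimes> z}" by blast
      have "K = range (\<lambda>k::nat. x [^] k)" unfolding x(2) pow[OF x(1)] ..
      moreover have "x \<in> K" "z \<in> K" unfolding x(2) by blast+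
      ultimately show ?thesis using that[of x] x(1) by (simp add: square_roots_def)
    qed
    have "K = generate G {x}" using generate_pow_on_finite_carrier[OF fin x(1)] x(4) by auto
    then have "subgroup K G" using generate_is_subgroup[of "{x}"] x(1) by simp
    then show "K \<in> {K. subgroup K G \<and> z \<in> K \<and> cyclic_group (G\<lparr>carrier := K\<rparr>)}"
      using x(2,3,4) cyclic_subgroup_iff[OF fin \<open>subgroup K G\<close>] by (intro CollectI conjI) blast+
  qed
qed

text \<open>
  A cyclic group of order four has exactly the two generators \<open>x\<close> and \<open>x z\<close>.
\<close>

lemma card_cyclic_containing:
  "2 * card {K. subgroup K G \<and> z \<in> K \<and> cyclic_group (G\<lparr>carrier := K\<rparr>)} =
   2 + card (square_roots G z)"
proof -
  let ?J = "square_roots G z" and ?q = "\<lambda>x. {\<one>, x, z, x \<otimes> z}"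
  have finJ: "finite ?J" using fin by (simp add: square_roots_def)
  have J: "x \<in> carrier G" "x \<otimes> x = z" "x \<noteq> \<one>" "x \<noteq> z" "x \<otimes> z \<noteq> x" if "x \<in> ?J" for x
  proof -
    show x: "x \<in> carrier G" "x \<otimes> x = z" using that by (auto simp: square_roots_def)
    show "x \<noteq> \<one>" "x \<noteq> z" using x(2) z_neq_one z_square by auto
    show "x \<otimes> z \<noteq> x" using x z_neq_one by simp
  qed
  have xz: "x \<otimes> z \<in> ?J" if "x \<in> ?J" for x
  proof -
    have "(x \<otimes> z) \<otimes> (x \<otimes> z) = (x \<otimes> z) \<otimes> (z \<otimes> x)" using J[OF that] z_comm by simp
    also have "\<dots> = x \<otimes> (z \<otimes> z) \<otimes> x" using J(1)[OF that] by (simp add: m_assoc)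
    also have "\<dots> = z" using J(1,2)[OF that] z_square by simp
    finally show ?thesis using J[OF that] by (simp add: square_roots_def)
  qed
  have fibre: "{y \<in> ?J. ?q y = ?q x} = {x, x \<otimes> z}" if x: "x \<in> ?J" for x
  proof (intro equalityI subsetI)
    fix y assume y: "y \<in> {y \<in> ?J. ?q y = ?q x}"
    then have "y \<in> {\<one>, x, z, x \<otimes> z}" by blast
    then show "y \<in> {x, x \<otimes> z}" using y J[of y] by auto
  next
    fix y assume y: "y \<in> {x, x \<otimes> z}"
    have "x \<otimes> z \<otimes> z = x" using J(1)[OF x] z_square by (simp add: m_assoc)
    then show "y \<in> {y \<in> ?J. ?q y = ?q x}" using y x xz[OF x] by auto
  qed
  have "card ?J = (\<Sum>x\<in>?J. 1::nat)" by simp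
  also have "\<dots> = (\<Sum>K\<in>?q ` ?J. \<Sum>x | x \<in> ?J \<and> ?q x = K. 1)"
    by (rule sum.group[symmetric]) (use finJ in auto)
  also have "\<dots> = (\<Sum>K\<in>?q ` ?J. 2)"
  proof (rule sum.cong[OF refl])
    fix K assume "K \<in> ?q ` ?J"
    then obtain x where x: "x \<in> ?J" "K = ?q x" by blast
    then have "card {y \<in> ?J. ?q y = K} = card {x, x \<otimes> z}" using fibre[OF x(1)] by simp
    also have "\<dots> = 2" using J(5)[OF x(1)] by (simp add: card_2_iff')
    finally show "(\<Sum>x | x \<in> ?J \<and> ?q x = K. 1::nat) = 2" by simp
  qed
  finally have "card ?J = 2 * card (?q ` ?J)" by simp
  moreover have "{\<one>, z} \<notin> ?q ` ?J"
  proof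
    assume "{\<one>, z} \<in> ?q ` ?J"
    then obtain x where "x \<in> ?J" "x \<in> {\<one>, z}" by blast
    then show False using J by blast
  qed
  ultimately show ?thesis unfolding cyclic_containing using finJ by simp
qed

lemma card_square_roots_sum: "card (square_roots G \<one>) + card (square_roots G z) = 2 ^ n"
proof -
  have "square_roots G \<one> \<union> square_roots G z = carrier G"
    using squares by (auto simp: square_roots_def)
  moreover have "square_roots G \<one> \<inter> square_roots G z = {}"
    using z_neq_one by (auto simp: square_roots_def)
  ultimately show ?thesis
    using card_Un_disjoint[of "square_roots G \<one>" "square_roots G z"] fin order
    by (simp add: order_def square_roots_def)
qed

text \<open>
  The noncyclic subgroups are those above \<open>z\<close>, minus the cyclic ones among them, plus the elementary
  abelian ones of order at least four that avoid \<open>z\<close>. Every square root of \<open>z\<close> contributes one half to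
  the cyclic ones, and their number is \<open>2\<^sup>n\<close> minus the number of solutions of \<open>x\<^sup>2 = 1\<close>; the formula is
  doubled and rearranged to avoid subtraction on the natural numbers.
\<close>

lemma delta_formula:
  "2 * delta G + 2 + 2 ^ n =
   2 * (\<Sum>k\<le>n. card (containing k)) + card (square_roots G \<one>) + 2 * (\<Sum>k=2..n. card (avoiding k))"
proof -
  let ?C = "{K. subgroup K G \<and> z \<in> K \<and> cyclic_group (G\<lparr>carrier := K\<rparr>)}"
  let ?N = "{K \<in> noncyclic_subgroups G. z \<in> K}" and ?M = "{K \<in> noncyclic_subgroups G. z \<notin> K}"
  have finS: "finite {K. subgroup K G}"
    by (rule finite_subset[of _ "Pow (carrier G)"]) (use fin subgroup.subset in auto)
  have fins: "finite ?C" "finite ?N" "finite ?M"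
    by (rule finite_subset[OF _ finS]; auto simp: noncyclic_subgroups_def)+
  have "noncyclic_subgroups G = ?N \<union> ?M" by auto
  then have d: "delta G = card ?N + card ?M"
    unfolding delta_def using card_Un_disjoint[OF fins(2,3)] by auto
  have "?N \<union> ?C = (\<Union>k\<in>{..n}. containing k)"
    unfolding subgroups_containing[symmetric] by (auto simp: noncyclic_subgroups_def)
  moreover have "?N \<inter> ?C = {}" by (auto simp: noncyclic_subgroups_def)
  ultimately have "card ?N + card ?C = card (\<Union>k\<in>{..n}. containing k)"
    using card_Un_disjoint[OF fins(2,1)] by simp
  also have "\<dots> = (\<Sum>k\<le>n. card (containing k))"
  proof (rule card_UN_disjoint)
    show "\<forall>i\<in>{..n}. finite (containing i)"
      using finS by (auto intro!: finite_subset[OF _ finS] simp: layer_def dest: elementary_overD(1))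
  qed (auto simp: layer_def card_one_z)
  finally have a: "card ?N + card ?C = (\<Sum>k\<le>n. card (containing k))" .
  have "card ?M = (\<Sum>k=2..n. card (avoiding k))"
    unfolding noncyclic_avoiding
  proof (rule card_UN_disjoint)
    show "\<forall>i\<in>{2..n}. finite (avoiding i)" using finite_avoiding[OF subgroup_self] by blast
  qed (auto simp: layer_def)
  then show ?thesis using d a card_cyclic_containing card_square_roots_sum by simp
qed

end

section \<open>Comparison with the extremal groups\<close>

context near_elementary_two_group
begin

text \<open>
  An elementary abelian \<open>H\<close> that is not central can be extended only inside a proper centralizer, hence
  by at most half of the group. If \<open>H\<close> is central, only the bound of three quarters for the solutions of
  \<open>x\<^sup>2 = 1\<close> is left. The resulting gain of one quarter is weighted with the number of central
  \<open>H\<close>, which obeys a recursion of its own: these \<open>H\<close> lie in the center, of index at least four in a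
  nonabelian group. In an abelian group the solutions of \<open>x\<^sup>2 = 1\<close> form a proper subgroup, so that there
  is no gain and \<open>r\<close> may be taken as zero.
\<close>

lemma card_avoiding_upper:
  assumes ne: "square_roots G \<one> \<noteq> carrier G"
  defines "r \<equiv> \<lambda>k. if center G = carrier G then 0 else card (central_avoiding k)"
  shows "frame_count 1 (Suc k) * card (avoiding (Suc k)) \<le>
      frame_count 1 k * (card (avoiding k) * (2 ^ (n - 1) - 2 * 2 ^ k) + r k * 2 ^ (n - 2))"
    and "frame_count 1 (Suc k) * r (Suc k) \<le> frame_count 1 k * (r k * (2 ^ (n - 2) - 2 * 2 ^ k))"
proof -
  obtain d where d: "n = d + 2" using n_ge by (metis add.commute le_Suc_ex)
  have ord: "card (carrier G) = 4 * 2 ^ d" using order d by (simp add: order_def)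
  have cI: "card (square_roots G \<one>) \<le> 3 * 2 ^ d"
    using card_square_roots_one[OF fin ne] order d by simp
  have bound: "card (carrier G \<inter> centralizer G H \<inter> square_roots G \<one>) \<le>
      2 * 2 ^ d + (if center G \<noteq> carrier G \<and> H \<in> central_avoiding k then 2 ^ d else 0)"
    if H: "H \<in> avoiding k" for H
  proof -
    let ?M = "carrier G \<inter> centralizer G H \<inter> square_roots G \<one>"
    have HG: "H \<subseteq> carrier G" and Hz: "z \<notin> H"
      using H elementary_overD(3,5) by (fastforce simp: layer_def)+
    have C: "subgroup (centralizer G H) G" by (rule subgroup_centralizer[OF HG])
    have CG: "centralizer G H \<subseteq> carrier G" by (rule subgroup.subset[OF C])
    have finI: "finite (square_roots G \<one>)" using fin by (simp add: square_roots_def)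
    consider "centralizer G H \<noteq> carrier G" | "center G = carrier G"
      | "centralizer G H = carrier G" "center G \<noteq> carrier G" by blast
    then show ?thesis
    proof cases
      case 1
      then have "2 * card (centralizer G H) \<le> card (carrier G)"
        using card_proper_subgroup[OF fin C subgroup_self] CG by blast
      moreover have "card ?M \<le> card (centralizer G H)"
        by (rule card_mono) (use CG fin in \<open>auto intro: finite_subset\<close>)
      ultimately show ?thesis using ord by simp
    next
      case 2
      have "x \<otimes> y = y \<otimes> x" if "x \<in> carrier G" "y \<in> carrier G" for x y
      proof -
        have "x \<in> center G" using 2 that(1) by simp
        then show ?thesis using that(2) by (simp add: centralizer_def)
      qed
      then have "subgroup (square_roots G \<one>) G"
        by (intro subgroup_square_roots_one) (auto simp: square_roots_def)
      moreover have "square_roots G \<one> \<subset> carrier G" using ne by (auto simp: square_roots_def)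
      ultimately have "2 * card (square_roots G \<one>) \<le> card (carrier G)"
        using card_proper_subgroup[OF fin _ subgroup_self] by blast
      moreover have "card ?M \<le> card (square_roots G \<one>)"
        by (rule card_mono[OF finI]) auto
      ultimately show ?thesis using ord by simp
    next
      case 3
      have "H \<subseteq> center G"
      proof
        fix h assume h: "h \<in> H"
        have "h \<otimes> x = x \<otimes> h" if x: "x \<in> carrier G" for x
        proof -
          have "x \<in> centralizer G H" using 3(1) x by simp
          then show ?thesis using h by (simp add: centralizer_def)
        qed
        then show "h \<in> center G" using h HG by (auto simp: centralizer_def)
      qed
      then have "H \<in> central_avoiding k"
        using H Hz by (auto simp: layer_def elementary_over_def)
      moreover have "card ?M \<le> card (square_roots G \<one>)"
        by (rule card_mono[OF finI]) auto
      ultimately show ?thesis using cI 3(2) by simp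
    qed
  qed
  have finA: "finite (avoiding k)" using finite_avoiding[OF subgroup_self] .
  have sub: "central_avoiding k \<subseteq> avoiding k"
    by (auto simp: layer_def elementary_over_def centralizer_def)
  have "(\<Sum>H\<in>avoiding k. card (carrier G \<inter> centralizer G H \<inter> square_roots G \<one>) - 2 * 2 ^ k) \<le>
      (\<Sum>H\<in>avoiding k. (2 * 2 ^ d - 2 * 2 ^ k) +
        (if center G \<noteq> carrier G \<and> H \<in> central_avoiding k then 2 ^ d else 0))"
  proof (rule sum_mono)
    fix H assume "H \<in> avoiding k"
    from bound[OF this] show "card (carrier G \<inter> centralizer G H \<inter> square_roots G \<one>) - 2 * 2 ^ k \<le>
      (2 * 2 ^ d - 2 * 2 ^ k) + (if center G \<noteq> carrier G \<and> H \<in> central_avoiding k then 2 ^ d else 0)"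
      by linarith
  qed
  also have "\<dots> = card (avoiding k) * (2 * 2 ^ d - 2 * 2 ^ k) + r k * 2 ^ d"
  proof (cases "center G = carrier G")
    case True
    then show ?thesis by (simp add: r_def)
  next
    case False
    have "(\<Sum>H\<in>avoiding k. if H \<in> central_avoiding k then 2 ^ d else 0) =
        (\<Sum>H\<in>avoiding k \<inter> central_avoiding k. 2 ^ d :: nat)"
      by (rule sum.inter_restrict[OF finA, symmetric])
    also have "avoiding k \<inter> central_avoiding k = central_avoiding k" using sub by blast
    finally show ?thesis using False by (simp add: sum.distrib r_def)
  qed
  finally show "frame_count 1 (Suc k) * card (avoiding (Suc k)) \<le>
      frame_count 1 k * (card (avoiding k) * (2 ^ (n - 1) - 2 * 2 ^ k) + r k * 2 ^ (n - 2))"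
    using avoiding_recursion[OF subgroup_self z_closed, of k] d by simp
  show "frame_count 1 (Suc k) * r (Suc k) \<le> frame_count 1 k * (r k * (2 ^ (n - 2) - 2 * 2 ^ k))"
  proof (cases "center G = carrier G")
    case True
    then show ?thesis by (simp add: r_def)
  next
    case False
    have cZ: "card (center G) \<le> 2 ^ d" using card_center_nonabelian[OF fin False] order d by simp
    have finZ: "finite (center G)" using fin by (simp add: centralizer_def)
    have "(\<Sum>H\<in>central_avoiding k. card (center G \<inter> centralizer G H \<inter> square_roots G \<one>) - 2 * 2 ^ k) \<le>
        (\<Sum>H\<in>central_avoiding k. 2 ^ d - 2 * 2 ^ k)"
    proof (rule sum_mono)
      fix H
      have "card (center G \<inter> centralizer G H \<inter> square_roots G \<one>) \<le> card (center G)"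
        by (rule card_mono[OF finZ]) auto
      then show "card (center G \<inter> centralizer G H \<inter> square_roots G \<one>) - 2 * 2 ^ k \<le> 2 ^ d - 2 * 2 ^ k"
        using cZ by (intro diff_le_mono) simp
    qed
    then show ?thesis
      using avoiding_recursion[OF subgroup_center z_central, of k] False d by (simp add: r_def)
  qed
qed

end

text \<open>
  In these groups all estimates above are attained: the solutions of \<open>x\<^sup>2 = 1\<close> fill three quarters of the
  group and form two elementary abelian subgroups of index two that meet in a central subgroup of index
  four.
\<close>

locale extremal_two_group = near_elementary_two_group +
  fixes A B
  assumes A: "subgroup A G" and B: "subgroup B G"
    and AB: "square_roots G \<one> = A \<union> B"
    and central: "A \<inter> B \<subseteq> center G"
    and card_A: "card A = 2 ^ (n - 1)" and card_B: "card B = 2 ^ (n - 1)"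
    and card_AB: "card (A \<inter> B) = 2 ^ (n - 2)"
begin

lemma card_involutions: "card (square_roots G \<one>) = 3 * 2 ^ (n - 2)"
proof -
  obtain d where d: "n = d + 2" using n_ge by (metis add.commute le_Suc_ex)
  have "finite A" "finite B"
    using subgroup.subset[OF A] subgroup.subset[OF B] fin finite_subset by blast+
  from card_Un_Int[OF this] show ?thesis using AB card_A card_B card_AB d by simp
qed

text \<open>
  A group is never the union of two proper subgroups.
\<close>

lemma subgroup_involutions:
  assumes H: "subgroup H G" and HI: "H \<subseteq> square_roots G \<one>"
  shows "H \<subseteq> A \<or> H \<subseteq> B"
proof (rule ccontr)
  assume "\<not> ?thesis"
  then obtain a b where ab: "a \<in> H" "a \<notin> A" "b \<in> H" "b \<notin> B" by blast
  then have a: "a \<in> B" and b: "b \<in> A" using HI AB by auto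
  have G: "a \<in> carrier G" "b \<in> carrier G" using ab H subgroup.mem_carrier by fastforce+
  have "a \<otimes> b \<in> A \<union> B" using ab H HI AB subgroup.m_closed by fastforce
  then show False
  proof
    assume "a \<otimes> b \<in> A"
    then have "(a \<otimes> b) \<otimes> inv b \<in> A" using b A by (meson subgroup_def)
    then show False using ab(2) G by (simp add: m_assoc)
  next
    assume "a \<otimes> b \<in> B"
    then have "inv a \<otimes> (a \<otimes> b) \<in> B" using a B by (meson subgroup_def)
    then show False using ab(4) G by (simp add: m_assoc[symmetric])
  qed
qed

text \<open>
  A subgroup \<open>H\<close> of exponent two lies in \<open>A\<close> or in \<open>B\<close>, and all elements of that abelian subgroup
  commute with \<open>H\<close>. This gives half of the group as candidates for extending \<open>H\<close>, and all solutions of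
  \<open>x\<^sup>2 = 1\<close> are candidates if \<open>H\<close> is central.
\<close>

lemma card_avoiding_lower:
  shows "frame_count 1 k * (card (avoiding k) * (2 ^ (n - 1) - 2 * 2 ^ k) +
        card (central_avoiding k) * 2 ^ (n - 2)) \<le>
      frame_count 1 (Suc k) * card (avoiding (Suc k))"
    and "frame_count 1 k * (card (central_avoiding k) * (2 ^ (n - 2) - 2 * 2 ^ k)) \<le>
      frame_count 1 (Suc k) * card (central_avoiding (Suc k))"
proof -
  obtain d where d: "n = d + 2" using n_ge by (metis add.commute le_Suc_ex)
  have ord: "card (carrier G) = 4 * 2 ^ d" using order d by (simp add: order_def)
  have finI: "finite (square_roots G \<one>)" using fin by (simp add: square_roots_def)
  have IG: "square_roots G \<one> \<subseteq> carrier G" by (auto simp: square_roots_def)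
  have cI: "card (square_roots G \<one>) = 3 * 2 ^ d" using card_involutions d by simp
  have bound: "(2 * 2 ^ d - 2 * 2 ^ k) + (if H \<in> central_avoiding k then 2 ^ d else 0) \<le>
      card (carrier G \<inter> centralizer G H \<inter> square_roots G \<one>) - 2 * 2 ^ k"
    if H: "H \<in> avoiding k" for H
  proof -
    have el: "H \<in> elementary_over G {\<one>} (carrier G - {z})" and cH: "card H = 2 ^ k"
      using H by (auto simp: layer_def)
    note H' = elementary_overD[OF el]
    have HI: "H \<subseteq> square_roots G \<one>" using H'(4,5) by (auto simp: square_roots_def)
    have comm: "S \<subseteq> carrier G \<inter> centralizer G H \<inter> square_roots G \<one>"
      if S: "subgroup S G" "S \<subseteq> square_roots G \<one>" "H \<subseteq> S" for S
    proof -
      have "x \<otimes> h = h \<otimes> x" if "x \<in> S" "h \<in> H" for x h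
      proof (rule involutions_commute)
        show "x \<otimes> h \<in> square_roots G \<one>" using that S subgroup.m_closed[OF S(1)] by blast
      qed (use that S in auto)
      then show ?thesis using S(2) IG by (auto simp: centralizer_def)
    qed
    have finM: "finite (carrier G \<inter> centralizer G H \<inter> square_roots G \<one>)" using finI by simp
    have "2 * 2 ^ d \<le> card (carrier G \<inter> centralizer G H \<inter> square_roots G \<one>)"
      using subgroup_involutions[OF H'(1) HI]
    proof
      assume "H \<subseteq> A"
      from card_mono[OF finM comm[OF A _ this]] show ?thesis using AB card_A d by simp
    next
      assume "H \<subseteq> B"
      from card_mono[OF finM comm[OF B _ this]] show ?thesis using AB card_B d by simp
    qed
    moreover have "3 * 2 ^ d \<le> card (carrier G \<inter> centralizer G H \<inter> square_roots G \<one>) \<and>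
        2 * 2 ^ k \<le> (2 * 2 ^ d :: nat)" if "H \<in> central_avoiding k"
    proof -
      have "H \<subseteq> center G" using that by (auto simp: layer_def elementary_over_def)
      then have "x \<otimes> h = h \<otimes> x" if "x \<in> carrier G" "h \<in> H" for x h
        using that by (auto simp: centralizer_def)
      then have "carrier G \<inter> centralizer G H \<inter> square_roots G \<one> = square_roots G \<one>"
        using IG by (auto simp: centralizer_def)
      \<comment> \<open>Subtraction below is truncated; this keeps \<open>2 * 2 ^ d - 2 * 2 ^ k\<close> exact.\<close>
      moreover have "2 * (2 * 2 ^ k) \<le> (4 * 2 ^ d :: nat)"
      proof -
        have zI: "adjoin G z H \<subseteq> square_roots G \<one>"
          using adjoin_z_subset[OF subgroup_self z_closed el] by blast
        have "adjoin G z H \<subset> carrier G"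
        proof
          show "adjoin G z H \<subseteq> carrier G" using zI IG by blast
          have "square_roots G \<one> \<noteq> carrier G" using cI ord by auto
          then show "adjoin G z H \<noteq> carrier G" using zI IG by blast
        qed
        moreover have "subgroup (adjoin G z H) G"
        proof (rule subgroup_adjoin[OF H'(1) z_closed])
          fix h assume "h \<in> H"
          then have "z \<otimes> h \<in> square_roots G \<one>" using zI by (auto simp: adjoin_def)
          then show "(z \<otimes> h) \<otimes> (z \<otimes> h) \<in> H" using H'(2) by (simp add: square_roots_def)
        qed
        ultimately have "2 * card (adjoin G z H) \<le> card (carrier G)"
          using card_proper_subgroup[OF fin _ subgroup_self] by blast
        moreover have "card (adjoin G z H) = 2 * card H"
          by (rule card_adjoin[OF fin H'(1) z_closed]) (use H'(3) in auto)
        ultimately show ?thesis using cH ord by simp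
      qed
      ultimately show ?thesis using cI by simp
    qed
    ultimately show ?thesis by (cases "H \<in> central_avoiding k") (simp; linarith)+
  qed
  have finA: "finite (avoiding k)" using finite_avoiding[OF subgroup_self] .
  have sub: "central_avoiding k \<subseteq> avoiding k"
    by (auto simp: layer_def elementary_over_def centralizer_def)
  have "(\<Sum>H\<in>avoiding k. if H \<in> central_avoiding k then 2 ^ d else 0) =
      (\<Sum>H\<in>avoiding k \<inter> central_avoiding k. 2 ^ d :: nat)"
    by (rule sum.inter_restrict[OF finA, symmetric])
  also have "avoiding k \<inter> central_avoiding k = central_avoiding k" using sub by blast
  finally have "card (avoiding k) * (2 * 2 ^ d - 2 * 2 ^ k) + card (central_avoiding k) * 2 ^ d =
      (\<Sum>H\<in>avoiding k. (2 * 2 ^ d - 2 * 2 ^ k) + (if H \<in> central_avoiding k then 2 ^ d else 0))"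
    by (simp add: sum.distrib)
  also have "\<dots> \<le> (\<Sum>H\<in>avoiding k. card (carrier G \<inter> centralizer G H \<inter> square_roots G \<one>) - 2 * 2 ^ k)"
    by (rule sum_mono) (rule bound)
  finally show "frame_count 1 k * (card (avoiding k) * (2 ^ (n - 1) - 2 * 2 ^ k) +
        card (central_avoiding k) * 2 ^ (n - 2)) \<le>
      frame_count 1 (Suc k) * card (avoiding (Suc k))"
    using avoiding_recursion[OF subgroup_self z_closed, of k] d by simp
  have "card (central_avoiding k) * (2 ^ d - 2 * 2 ^ k) =
      (\<Sum>H\<in>central_avoiding k. 2 ^ d - 2 * 2 ^ k)" by simp
  also have "\<dots> \<le> (\<Sum>H\<in>central_avoiding k. card (center G \<inter> centralizer G H \<inter> square_roots G \<one>) - 2 * 2 ^ k)"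
  proof (rule sum_mono)
    fix H assume "H \<in> central_avoiding k"
    then have HG: "H \<subseteq> carrier G" by (auto simp: layer_def elementary_over_def centralizer_def)
    have "A \<inter> B \<subseteq> center G \<inter> centralizer G H \<inter> square_roots G \<one>"
      using central AB HG by (auto simp: centralizer_def)
    then have "card (A \<inter> B) \<le> card (center G \<inter> centralizer G H \<inter> square_roots G \<one>)"
      using finI by (intro card_mono) auto
    then show "2 ^ d - 2 * 2 ^ k \<le> card (center G \<inter> centralizer G H \<inter> square_roots G \<one>) - 2 * 2 ^ k"
      using card_AB d by (intro diff_le_mono) simp
  qed
  finally show "frame_count 1 k * (card (central_avoiding k) * (2 ^ (n - 2) - 2 * 2 ^ k)) \<le>
      frame_count 1 (Suc k) * card (central_avoiding (Suc k))"
    using avoiding_recursion[OF subgroup_center z_central, of k] d by simp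
qed

end

text \<open>
  The recursions bound the layers of \<open>G\<close> by those of \<open>D\<close> term by term: first the central
  subgroups that avoid the involution, then all that avoid it.
\<close>

lemma delta_le_extremal:
  assumes "near_elementary_two_group G z n" and ne: "square_roots G \<one>\<^bsub>G\<^esub> \<noteq> carrier G"
    and "extremal_two_group D w n A B"
  shows "delta G \<le> delta D"
proof -
  interpret G: near_elementary_two_group G z n by fact
  interpret D: extremal_two_group D w n A B by fact
  define r where "r = (\<lambda>k. if center G = carrier G then 0 else card (G.central_avoiding k))"
  have pos: "frame_count b k > 0" if "b > 0" for b k using that by (rule frame_count_pos)
  have r: "r k \<le> card (D.central_avoiding k)" for k
  proof (induction k)
    case 0
    show ?case
      by (simp add: r_def G.avoiding_zero[OF G.subgroup_center] D.avoiding_zero[OF D.subgroup_center])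
  next
    case (Suc k)
    have "frame_count 1 (Suc k) * r (Suc k) \<le> frame_count 1 k * (r k * (2 ^ (n - 2) - 2 * 2 ^ k))"
      using G.card_avoiding_upper(2)[OF ne] by (simp add: r_def)
    also have "\<dots> \<le> frame_count 1 k * (card (D.central_avoiding k) * (2 ^ (n - 2) - 2 * 2 ^ k))"
      using Suc by (intro mult_le_mono order.refl)
    also have "\<dots> \<le> frame_count 1 (Suc k) * card (D.central_avoiding (Suc k))"
      by (rule D.card_avoiding_lower(2))
    finally show ?case using pos[of 1 "Suc k"] by simp
  qed
  have av: "card (G.avoiding k) \<le> card (D.avoiding k)" for k
  proof (induction k)
    case 0
    show ?case
      by (simp add: G.avoiding_zero[OF G.subgroup_self] D.avoiding_zero[OF D.subgroup_self])
  next
    case (Suc k)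
    have "frame_count 1 (Suc k) * card (G.avoiding (Suc k)) \<le>
        frame_count 1 k * (card (G.avoiding k) * (2 ^ (n - 1) - 2 * 2 ^ k) + r k * 2 ^ (n - 2))"
      using G.card_avoiding_upper(1)[OF ne] by (simp add: r_def)
    also have "\<dots> \<le> frame_count 1 k * (card (D.avoiding k) * (2 ^ (n - 1) - 2 * 2 ^ k) +
        card (D.central_avoiding k) * 2 ^ (n - 2))"
      using Suc r by (intro mult_le_mono add_mono order.refl)
    also have "\<dots> \<le> frame_count 1 (Suc k) * card (D.avoiding (Suc k))"
      by (rule D.card_avoiding_lower(1))
    finally show ?case using pos[of 1 "Suc k"] by simp
  qed
  have co: "card (G.containing k) = card (D.containing k)" for k
  proof (induction k)
    case 0
    show ?case by (simp add: G.containing_zero D.containing_zero)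
  next
    case (Suc k)
    have "frame_count 2 (Suc k) * card (G.containing (Suc k)) =
        frame_count 2 (Suc k) * card (D.containing (Suc k))"
      unfolding G.containing_recursion D.containing_recursion Suc ..
    then show ?case using pos[of 2 "Suc k"] by simp
  qed
  have I: "card (square_roots G \<one>\<^bsub>G\<^esub>) \<le> card (square_roots D \<one>\<^bsub>D\<^esub>)"
  proof -
    obtain d where "n = d + 2" using G.n_ge by (metis add.commute le_Suc_ex)
    then show ?thesis
      using G.card_square_roots_one[OF G.fin ne] G.order D.card_involutions by simp
  qed
  have "(\<Sum>k=2..n. card (G.avoiding k)) \<le> (\<Sum>k=2..n. card (D.avoiding k))"
    by (rule sum_mono) (rule av)
  then show ?thesis using G.delta_formula D.delta_formula I co by simp
qed

section \<open>The product of the dihedral group of order eight with an elementary abelian group\<close>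

lemma carrier_dihedral_group_4: "carrier (dihedral_group 4) = {0, 1, 2, 3} \<times> {False, True}"
  by (auto simp: dihedral_group_def)

lemma mult_dihedral_group_4:
  "(i, a) \<otimes>\<^bsub>dihedral_group 4\<^esub> (j, b) = ((if a then i - j else i + j) mod 4, a \<noteq> b)"
  by (simp add: dihedral_group_def)

lemma one_dihedral_group_4: "\<one>\<^bsub>dihedral_group 4\<^esub> = (0, False)"
  by (simp add: dihedral_group_def)

lemmas dihedral_group_4_simps = carrier_dihedral_group_4 mult_dihedral_group_4 one_dihedral_group_4

lemma C2_power_square:
  assumes "f \<in> carrier (C2_power d)"
  shows "f \<otimes>\<^bsub>C2_power d\<^esub> f = \<one>\<^bsub>C2_power d\<^esub>"
  using assms by (auto simp: C2_power_def carrier_integer_mod_group integer_mod_group_def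
      PiE_iff intro!: restrict_ext)

lemma C2_power_commute: "f \<otimes>\<^bsub>C2_power d\<^esub> g = g \<otimes>\<^bsub>C2_power d\<^esub> f"
  by (simp add: C2_power_def integer_mod_group_def add.commute)

text \<open>
  In \<open>D\<^sub>8\<close> the elements squaring to one form two Klein four-groups, each generated by the central rotation
  \<open>r\<^sup>2\<close> and a reflection, that meet in the center. Taking the product with a group of exponent two
  preserves this picture.
\<close>

lemma extremal_dihedral:
  "extremal_two_group (dihedral_group 4 \<times>\<times> C2_power d) ((2, False), \<one>\<^bsub>C2_power d\<^esub>) (d + 3)
     ({(0, False), (2, False), (0, True), (2, True)} \<times> carrier (C2_power d))
     ({(0, False), (2, False), (1, True), (3, True)} \<times> carrier (C2_power d))"
  (is "extremal_two_group (?D \<times>\<times> ?E) ?z _ (?A \<times> _) (?B \<times> _)")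
proof -
  interpret D: group ?D by (rule group_dihedral_group) simp
  interpret E: group ?E by (rule group_C2_power)
  interpret P: group "?D \<times>\<times> ?E" by (rule DirProd_group) unfold_locales
  have cE: "card (carrier ?E) = 2 ^ d" using order_C2_power by (simp add: order_def)
  have sub: "subgroup (S \<times> carrier ?E) (?D \<times>\<times> ?E)" if "subgroup S ?D" for S
    by (rule DirProd_subgroups[OF D.is_group that E.is_group E.subgroup_self])
  have fin: "finite (carrier ?E)" using cE by (metis card.infinite power_not_zero zero_neq_numeral)
  have inv_D: "inv\<^bsub>?D\<^esub> x = x" if "x \<otimes>\<^bsub>?D\<^esub> x = \<one>\<^bsub>?D\<^esub>" "x \<in> carrier ?D" for x
    using D.inv_equality[OF that(1)] that(2) by simp
  have A: "subgroup ?A ?D"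
    by (rule D.subgroupI) (auto simp: dihedral_group_4_simps inv_D)
  have B: "subgroup ?B ?D"
    by (rule D.subgroupI) (auto simp: dihedral_group_4_simps inv_D)
  have "(2, False) \<otimes>\<^bsub>?D\<^esub> x = x \<otimes>\<^bsub>?D\<^esub> (2, False)" if "x \<in> carrier ?D" for x
    using that unfolding carrier_dihedral_group_4 by (auto simp: mult_dihedral_group_4)
  moreover have "(2, False) \<in> carrier ?D" by (simp add: carrier_dihedral_group_4)
  ultimately have "(2, False) \<in> center ?D" by (simp add: centralizer_def)
  moreover have "(0, False) \<in> center ?D"
    using D.one_closed by (simp add: centralizer_def one_dihedral_group_4[symmetric])
  moreover have "(a, f) \<in> center (?D \<times>\<times> ?E)" if "a \<in> center ?D" "f \<in> carrier ?E" for a f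
    using that C2_power_commute[where f=f and d=d] by (auto simp: centralizer_def)
  ultimately have cen: "{(0, False), (2, False)} \<times> carrier ?E \<subseteq> center (?D \<times>\<times> ?E)"
    by blast
  have sq: "x \<otimes>\<^bsub>?D\<^esub> x = (if x \<in> ?A \<union> ?B then (0, False) else (2, False))" if "x \<in> carrier ?D" for x
    using that unfolding carrier_dihedral_group_4 by (elim SigmaE insertE emptyE) (simp_all add: mult_dihedral_group_4)
  have "near_elementary_two_group (?D \<times>\<times> ?E) ?z (d + 3)"
  proof
    show "finite (carrier (?D \<times>\<times> ?E))"
      using fin by (simp add: carrier_dihedral_group_4)
    show "?z \<in> center (?D \<times>\<times> ?E)" using cen E.one_closed by blast
    show "?z \<noteq> \<one>\<^bsub>?D \<times>\<times> ?E\<^esub>"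
      by (simp add: one_dihedral_group_4)
    show "?z \<otimes>\<^bsub>?D \<times>\<times> ?E\<^esub> ?z = \<one>\<^bsub>?D \<times>\<times> ?E\<^esub>"
      by (simp add: one_dihedral_group_4 mult_dihedral_group_4)
    show "order (?D \<times>\<times> ?E) = 2 ^ (d + 3)"
      using order_dihedral_group[of 4] by (simp add: order_def card_cartesian_product cE power_add)
    show "2 \<le> d + 3" by simp
    show "x \<otimes>\<^bsub>?D \<times>\<times> ?E\<^esub> x \<in> {\<one>\<^bsub>?D \<times>\<times> ?E\<^esub>, ?z}" if "x \<in> carrier (?D \<times>\<times> ?E)" for x
    proof -
      obtain a f where x: "x = (a, f)" "a \<in> carrier ?D" "f \<in> carrier ?E" using \<open>x \<in> _\<close> by auto
      then show ?thesis using sq[OF x(2)] C2_power_square[OF x(3)] by (simp add: one_dihedral_group_4)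
    qed
  qed
  then show ?thesis
  proof (rule extremal_two_group.intro, intro extremal_two_group_axioms.intro)
    show "subgroup (?A \<times> carrier ?E) (?D \<times>\<times> ?E)" by (rule sub[OF A])
    show "subgroup (?B \<times> carrier ?E) (?D \<times>\<times> ?E)" by (rule sub[OF B])
    show "square_roots (?D \<times>\<times> ?E) \<one>\<^bsub>?D \<times>\<times> ?E\<^esub> = ?A \<times> carrier ?E \<union> ?B \<times> carrier ?E"
      unfolding Sigma_Un_distrib1[symmetric]
    proof (intro equalityI subsetI)
      fix x assume "x \<in> square_roots (?D \<times>\<times> ?E) \<one>\<^bsub>?D \<times>\<times> ?E\<^esub>"
      then obtain a f where x: "x = (a, f)" "a \<in> carrier ?D" "f \<in> carrier ?E"
          "a \<otimes>\<^bsub>?D\<^esub> a = (0, False)"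
        by (auto simp: square_roots_def one_dihedral_group_4)
      then have "a \<in> ?A \<union> ?B" using sq[OF x(2)] by (simp split: if_splits)
      then show "x \<in> (?A \<union> ?B) \<times> carrier ?E" unfolding x(1) using x(3) by (rule SigmaI)
    next
      fix x assume "x \<in> (?A \<union> ?B) \<times> carrier ?E"
      then obtain a f where x: "x = (a, f)" "a \<in> ?A \<union> ?B" "f \<in> carrier ?E" by (rule SigmaE)
      then have "a \<in> carrier ?D" using subgroup.subset[OF A] subgroup.subset[OF B] by (elim UnE) (erule (1) subsetD)+
      moreover from this have "a \<otimes>\<^bsub>?D\<^esub> a = (0, False)" using sq x(2) by simp
      ultimately show "x \<in> square_roots (?D \<times>\<times> ?E) \<one>\<^bsub>?D \<times>\<times> ?E\<^esub>"
        unfolding x(1) using x(3) C2_power_square[OF x(3)] by (simp add: square_roots_def one_dihedral_group_4)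
    qed
    have int: "(?A \<times> carrier ?E) \<inter> (?B \<times> carrier ?E) = {(0, False), (2, False)} \<times> carrier ?E"
      by auto
    show "(?A \<times> carrier ?E) \<inter> (?B \<times> carrier ?E) \<subseteq> center (?D \<times>\<times> ?E)"
      unfolding int by (rule cen)
    show "card (?A \<times> carrier ?E) = 2 ^ (d + 3 - 1)" "card (?B \<times> carrier ?E) = 2 ^ (d + 3 - 1)"
      unfolding card_cartesian_product cE by simp_all
    show "card ((?A \<times> carrier ?E) \<inter> (?B \<times> carrier ?E)) = 2 ^ (d + 3 - 2)"
      unfolding int card_cartesian_product cE by simp
  qed
qed

section \<open>Involutions in 2-groups\<close>

context group
begin

lemma involution_power:
  assumes x: "x \<in> carrier G" "x \<noteq> \<one>" and pow: "x [^] ((2::nat) ^ n) = \<one>"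
  obtains k :: nat where "x [^] k \<noteq> \<one>" "x [^] k \<otimes> x [^] k = \<one>"
proof -
  define j where "j = (LEAST j. x [^] ((2::nat) ^ j) = \<one>)"
  have j: "x [^] ((2::nat) ^ j) = \<one>" unfolding j_def by (rule LeastI[of _ n]) (rule pow)
  have "j \<noteq> 0" using j x by (intro notI) simp
  then obtain i where i: "j = Suc i" using not0_implies_Suc by blast
  have "x [^] ((2::nat) ^ i) \<noteq> \<one>" using not_less_Least[of i "\<lambda>j. x [^] ((2::nat) ^ j) = \<one>"] i unfolding j_def by simp
  moreover have "x [^] ((2::nat) ^ i) \<otimes> x [^] ((2::nat) ^ i) = \<one>"
    using j x(1) by (simp add: i nat_pow_mult mult_2)
  ultimately show thesis by (rule that)
qed

text \<open>
  Writing two involutions as \<open>g\<^sup>a\<close> and \<open>g\<^sup>b\<close>, both \<open>2 a\<close> and \<open>2 b\<close> are odd multiples of the order of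
  \<open>g\<close>, so \<open>a - b\<close> is a multiple of that order.
\<close>

lemma cyclic_subgroup_unique_involution:
  assumes fin: "finite (carrier G)" and K: "subgroup K G" "cyclic_group (G\<lparr>carrier := K\<rparr>)"
    and x: "x \<in> K" "x \<noteq> \<one>" "x \<otimes> x = \<one>" and y: "y \<in> K" "y \<noteq> \<one>" "y \<otimes> y = \<one>"
  shows "x = y"
proof -
  obtain g where g: "g \<in> K" "K = range (\<lambda>k::nat. g [^] k)"
    using K(2) cyclic_subgroup_iff[OF fin K(1)] by blast
  have gG: "g \<in> carrier G" by (rule subgroup.mem_carrier[OF K(1) g(1)])
  obtain a b :: nat where ab: "x = g [^] a" "y = g [^] b" using x(1) y(1) unfolding g(2) by blast
  have odd: "\<exists>s. 2 * int a = int (ord g) * s \<and> odd s"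
    if "g [^] a \<noteq> \<one>" "g [^] a \<otimes> g [^] a = \<one>" for a :: nat
  proof -
    have "g [^] (a + a) = \<one>" using that(2) gG by (simp add: nat_pow_mult)
    then have "ord g dvd a + a" using pow_eq_id[OF gG] by blast
    then obtain s where s: "2 * a = ord g * s" by (auto simp: mult_2)
    have "odd s"
    proof
      assume "even s"
      then obtain t where "s = 2 * t" by blast
      then have "a = ord g * t" using s by simp
      then show False using that(1) pow_eq_id[OF gG] by simp
    qed
    moreover have "2 * int a = int (ord g) * int s" using s by (metis of_nat_mult of_nat_numeral)
    ultimately show ?thesis by (intro exI[of _ "int s"]) simp
  qed
  obtain s where s: "2 * int a = int (ord g) * s" "odd s" using odd[of a] x ab by auto
  obtain t where t: "2 * int b = int (ord g) * t" "odd t" using odd[of b] y ab by auto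
  have "even (t - s)" using s(2) t(2) by simp
  then obtain u where u: "t - s = 2 * u" by (rule dvdE)
  have "2 * (int b - int a) = int (ord g) * (t - s)"
    unfolding right_diff_distrib s(1) t(1) ..
  also have "\<dots> = 2 * (int (ord g) * u)" unfolding u by (rule mult.left_commute)
  finally have "int b - int a = int (ord g) * u" by (simp only: mult_cancel_left) simp
  then have "int (ord g) dvd int b - int a" by simp
  then have "g [^] int a = g [^] int b" using int_pow_eq[OF gG] by blast
  then show ?thesis using ab by (simp add: int_pow_int)
qed

text \<open>
  The conjugacy classes in \<open>N\<close> have sizes that are powers of two. If no element of \<open>N\<close> other than \<open>1\<close> were
  central, all classes except that of \<open>1\<close> would be even and \<open>N\<close> would have odd order. A suitable
  power of a central element is an involution.
\<close>

lemma normal_subgroup_central_involution: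
  assumes order: "order G = 2 ^ n" and N: "N \<lhd> G" "N \<noteq> {\<one>}"
  obtains z where "z \<in> N" "z \<in> center G" "z \<noteq> \<one>" "z \<otimes> z = \<one>"
proof -
  define \<phi> where "\<phi> = (\<lambda>g. \<lambda>h\<in>carrier G. g \<otimes> h \<otimes> inv g)"
  interpret act: group_action G "carrier G" \<phi>
    unfolding \<phi>_def by (rule action_by_conjugation)
  have fin: "finite (carrier G)" using order order_gt_0_iff_finite by simp
  have Ns: "subgroup N G" and Nc: "\<And>x h. x \<in> carrier G \<Longrightarrow> h \<in> N \<Longrightarrow> x \<otimes> h \<otimes> inv x \<in> N"
    using N(1) unfolding normal_inv_iff by simp_all
  have NG: "N \<subseteq> carrier G" by (rule subgroup.subset[OF Ns])
  have oneN: "\<one> \<in> N" by (rule subgroup.one_closed[OF Ns])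
  have finN: "finite N" by (rule finite_subset[OF NG fin])
  have orbI: "g \<otimes> x \<otimes> inv g \<in> orbit G \<phi> x" if "x \<in> carrier G" "g \<in> carrier G" for g x
    using that by (auto simp: orbit_def \<phi>_def)
  have orbE: "\<exists>g\<in>carrier G. y = g \<otimes> x \<otimes> inv g" if "x \<in> carrier G" "y \<in> orbit G \<phi> x" for x y
    using that by (auto simp: orbit_def \<phi>_def)
  have "\<exists>z\<in>N. z \<in> center G \<and> z \<noteq> \<one>"
  proof (rule ccontr)
    assume no: "\<not> ?thesis"
    let ?C = "(orbit G \<phi>) ` (N - {\<one>})"
    have even: "2 dvd card (orbit G \<phi> x)" if x: "x \<in> N - {\<one>}" for x
    proof -
      have xG: "x \<in> carrier G" using x NG by auto
      have "card (orbit G \<phi> x) dvd 2 ^ n"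
        unfolding order[symmetric] act.orbit_stabilizer_theorem[OF xG, symmetric] by simp
      then obtain i where i: "card (orbit G \<phi> x) = 2 ^ i"
        using divides_primepow_nat[of 2 _ n] by auto
      have "i \<noteq> 0"
      proof
        assume "i = 0"
        then have "card (orbit G \<phi> x) = 1" using i by simp
        then obtain y where y: "orbit G \<phi> x = {y}" by (rule card_1_singletonE)
        have "x \<in> orbit G \<phi> x" by (rule act.orbit_refl[OF xG])
        then have o: "orbit G \<phi> x = {x}" using y by simp
        have "x \<otimes> g = g \<otimes> x" if g: "g \<in> carrier G" for g
        proof -
          have "g \<otimes> x \<otimes> inv g = x" using orbI[OF xG g] unfolding o by simp
          then have "x \<otimes> g = g \<otimes> x \<otimes> inv g \<otimes> g" by simp
          also have "\<dots> = g \<otimes> x" using g xG by (simp add: m_assoc)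
          finally show ?thesis .
        qed
        then have "x \<in> center G" using xG by (simp add: centralizer_def)
        then show False using no x by auto
      qed
      then show ?thesis using i by simp
    qed
    have Un: "\<Union>?C = N - {\<one>}"
    proof (intro equalityI subsetI)
      fix y assume "y \<in> \<Union>?C"
      then obtain x where x: "x \<in> N" "x \<noteq> \<one>" "y \<in> orbit G \<phi> x" by auto
      have xG: "x \<in> carrier G" using x NG by auto
      obtain g where g: "g \<in> carrier G" "y = g \<otimes> x \<otimes> inv g" using orbE[OF xG x(3)] by auto
      have "y \<noteq> \<one>"
      proof
        assume "y = \<one>"
        then have "g \<otimes> x = g" using g xG by (metis inv_solve_right' l_one m_closed one_closed)
        then show False using x(2) g(1) xG by simp
      qed
      then show "y \<in> N - {\<one>}" using Nc[OF g(1) x(1)] g(2) by simp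
    next
      fix y assume y: "y \<in> N - {\<one>}"
      then have "y \<in> orbit G \<phi> y" using act.orbit_refl NG by auto
      then show "y \<in> \<Union>?C" using y by blast
    qed
    have "2 dvd card (\<Union>?C)"
    proof (rule dvd_partition)
      show "finite (\<Union>?C)" unfolding Un using finN by simp
      show "\<forall>c\<in>?C. 2 dvd card c" using even by simp
      have "?C \<subseteq> orbits G (carrier G) \<phi>" using NG by (auto simp: orbits_def)
      then show "\<forall>c1\<in>?C. \<forall>c2\<in>?C. c1 \<noteq> c2 \<longrightarrow> c1 \<inter> c2 = {}"
        using act.disjoint_union by (meson subsetD)
    qed
    then have "even (card (N - {\<one>}))" unfolding Un .
    moreover have "Suc (card (N - {\<one>})) = card N" by (rule card_Suc_Diff1[OF finN oneN])
    ultimately have odd: "odd (card N)" by (metis even_Suc)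
    have "card N dvd 2 ^ n"
      unfolding order[symmetric] lagrange[OF Ns, symmetric] by simp
    then obtain j where "card N = 2 ^ j" using divides_primepow_nat[of 2 _ n] by auto
    then have "card N = 1" using odd by (cases j) simp_all
    then obtain y where "N = {y}" by (rule card_1_singletonE)
    then show False using N(2) oneN by simp
  qed
  then obtain x where x: "x \<in> N" "x \<in> center G" "x \<noteq> \<one>" by auto
  have xG: "x \<in> carrier G" using x NG by auto
  have "x [^] ((2::nat) ^ n) = \<one>" using pow_order_eq_1[OF xG] order by simp
  then obtain k :: nat where k: "x [^] k \<noteq> \<one>" "x [^] k \<otimes> x [^] k = \<one>"
    by (rule involution_power[OF xG x(3)])
  have mem: "x [^] k \<in> S" if "subgroup S G" "x \<in> S" for S
    by (induction k) (use that in \<open>auto simp: subgroup.one_closed subgroup.m_closed\<close>)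
  have "x [^] k \<in> center G" by (rule mem[OF subgroup_centralizer x(2)]) simp
  then show thesis by (rule that[OF mem[OF Ns x(1)] _ k])
qed

end

section \<open>Replacing a group by a direct product\<close>

text \<open>
  The model for \<open>P\<close> is the product of \<open>G / {1, z}\<close> with the group \<open>{1, c}\<close> of order two, where \<open>p\<close> is the
  projection to the first factor. A subgroup \<open>K\<close> of \<open>G\<close> that contains \<open>z\<close> is sent to
  \<open>p K \<times> {1, c}\<close>. If \<open>K\<close> avoids \<open>z\<close>, then \<open>K\<close> is one of the complements of \<open>{1, z}\<close> in \<open>L = K \<union> z K\<close>.
  Relative to a fixed complement, the complements correspond to homomorphisms from \<open>p L\<close> to \<open>{1, c}\<close>,
  and \<open>K\<close> is sent to the graph of its homomorphism, which is isomorphic to \<open>K\<close>.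
\<close>

locale central_replacement = central_involution G z + P: group P
  for G (structure) and z and P (structure) +
  fixes n :: nat and p c
  assumes order: "order G = 2 ^ n"
    and finP: "finite (carrier P)"
    and hom: "p \<in> hom G P"
    and ker: "x \<in> carrier G \<Longrightarrow> p x = \<one>\<^bsub>P\<^esub> \<longleftrightarrow> x = \<one>\<^bsub>G\<^esub> \<or> x = z"
    and c_central: "c \<in> center P" and c_square: "c \<otimes>\<^bsub>P\<^esub> c = \<one>\<^bsub>P\<^esub>"
    and c_outside: "c \<notin> p ` carrier G"
begin

lemma p_closed [simp]: "x \<in> carrier G \<Longrightarrow> p x \<in> carrier P"
  using hom by (rule hom_in_carrier)

lemma p_mult: "x \<in> carrier G \<Longrightarrow> y \<in> carrier G \<Longrightarrow> p (x \<otimes>\<^bsub>G\<^esub> y) = p x \<otimes>\<^bsub>P\<^esub> p y"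
  using hom by (rule hom_mult)

lemma p_group_hom: "group_hom G P p"
  using hom by unfold_locales

lemma c_closed [simp]: "c \<in> carrier P"
  using c_central by (simp add: centralizer_def)

lemma c_comm: "y \<in> carrier P \<Longrightarrow> y \<otimes>\<^bsub>P\<^esub> c = c \<otimes>\<^bsub>P\<^esub> y"
  using c_central by (simp add: centralizer_def)

lemma p_quotient:
  "x \<in> carrier G \<Longrightarrow> y \<in> carrier G \<Longrightarrow> p (x \<otimes>\<^bsub>G\<^esub> inv\<^bsub>G\<^esub> y) = p x \<otimes>\<^bsub>P\<^esub> inv\<^bsub>P\<^esub> p y"
  by (simp add: p_mult group_hom.hom_inv[OF p_group_hom])

lemma p_eq_iff:
  assumes x: "x \<in> carrier G" and y: "y \<in> carrier G"
  shows "p x = p y \<longleftrightarrow> x = y \<or> x = z \<otimes>\<^bsub>G\<^esub> y"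
proof -
  have xy: "x \<otimes>\<^bsub>G\<^esub> inv\<^bsub>G\<^esub> y \<in> carrier G" using x y by simp
  have "p x = p y \<longleftrightarrow> p x \<otimes>\<^bsub>P\<^esub> inv\<^bsub>P\<^esub> p y = \<one>\<^bsub>P\<^esub>"
    using P.inv_solve_right'[of "\<one>\<^bsub>P\<^esub>" "p x" "p y"] x y by simp
  also have "\<dots> \<longleftrightarrow> x \<otimes>\<^bsub>G\<^esub> inv\<^bsub>G\<^esub> y = \<one>\<^bsub>G\<^esub> \<or> x \<otimes>\<^bsub>G\<^esub> inv\<^bsub>G\<^esub> y = z"
    unfolding p_quotient[OF x y, symmetric] by (rule ker[OF xy])
  also have "\<dots> \<longleftrightarrow> x = y \<or> x = z \<otimes>\<^bsub>G\<^esub> y"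
    using inv_solve_right'[of "\<one>\<^bsub>G\<^esub>" x y] inv_solve_right'[of z x y] x y by simp
  finally show ?thesis .
qed

lemma c_p_neq:
  assumes x: "x \<in> carrier G" and y: "y \<in> carrier G"
  shows "c \<otimes>\<^bsub>P\<^esub> p x \<noteq> p y"
proof
  assume "c \<otimes>\<^bsub>P\<^esub> p x = p y"
  then have "p y \<otimes>\<^bsub>P\<^esub> inv\<^bsub>P\<^esub> p x = c \<otimes>\<^bsub>P\<^esub> p x \<otimes>\<^bsub>P\<^esub> inv\<^bsub>P\<^esub> p x" by simp
  also have "\<dots> = c" using x by (simp add: P.m_assoc)
  finally have "c = p (y \<otimes>\<^bsub>G\<^esub> inv\<^bsub>G\<^esub> x)" unfolding p_quotient[OF y x] ..
  then show False using c_outside x y by (metis imageI inv_closed m_closed)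
qed

lemma c_p_eq_iff:
  assumes "x \<in> carrier G" "y \<in> carrier G"
  shows "c \<otimes>\<^bsub>P\<^esub> p x = c \<otimes>\<^bsub>P\<^esub> p y \<longleftrightarrow> x = y \<or> x = z \<otimes>\<^bsub>G\<^esub> y"
  unfolding p_eq_iff[OF assms, symmetric]
  using P.l_cancel[OF _ p_closed[OF assms(1)] p_closed[OF assms(2)] c_closed] by auto

text \<open>
  A reference complement of \<open>{1, z}\<close> in \<open>L\<close>. It is chosen from \<open>L\<close> alone, so that it can be recovered
  from the image of a subgroup.
\<close>

definition complement :: "'a set \<Rightarrow> 'a set" where
  "complement L = (SOME K. subgroup K G \<and> z \<notin> K \<and> adjoin G z K = L)"

lemma complement:
  assumes "subgroup K G" "z \<notin> K"
  shows "subgroup (complement (adjoin G z K)) G" "z \<notin> complement (adjoin G z K)"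
    "adjoin G z (complement (adjoin G z K)) = adjoin G z K"
proof -
  have "subgroup (complement (adjoin G z K)) G \<and> z \<notin> complement (adjoin G z K) \<and>
      adjoin G z (complement (adjoin G z K)) = adjoin G z K"
    unfolding complement_def by (rule someI[of _ K]) (use assms in simp)
  then show "subgroup (complement (adjoin G z K)) G" "z \<notin> complement (adjoin G z K)"
    "adjoin G z (complement (adjoin G z K)) = adjoin G z K" by simp_all
qed

text \<open>
  Multiplication by \<open>z\<close> exchanges the two cosets of the reference complement.
\<close>

lemma shift_complement:
  assumes K: "subgroup K G" "z \<notin> K" and x: "x \<in> adjoin G z K"
  shows "z \<otimes>\<^bsub>G\<^esub> x \<in> complement (adjoin G z K) \<longleftrightarrow> x \<notin> complement (adjoin G z K)"
proof -
  let ?C = "complement (adjoin G z K)"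
  note C = complement[OF K]
  have "x \<in> adjoin G z ?C" using x C(3) by simp
  then have "x \<in> ?C \<or> (\<exists>k\<in>?C. x = z \<otimes>\<^bsub>G\<^esub> k)" by (auto simp: adjoin_def)
  then have *: "x \<in> ?C \<or> z \<otimes>\<^bsub>G\<^esub> x \<in> ?C"
  proof
    assume "\<exists>k\<in>?C. x = z \<otimes>\<^bsub>G\<^esub> k"
    then obtain k where k: "k \<in> ?C" "x = z \<otimes>\<^bsub>G\<^esub> k" by auto
    have kG: "k \<in> carrier G" by (rule subgroup.mem_carrier[OF C(1) k(1)])
    have "z \<otimes>\<^bsub>G\<^esub> x = z \<otimes>\<^bsub>G\<^esub> z \<otimes>\<^bsub>G\<^esub> k" unfolding k(2) using kG by (simp add: m_assoc)
    then have "z \<otimes>\<^bsub>G\<^esub> x = k" using z_square kG by simp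
    then show ?thesis using k(1) by simp
  qed simp
  have "\<not> (x \<in> ?C \<and> z \<otimes>\<^bsub>G\<^esub> x \<in> ?C)"
  proof
    assume a: "x \<in> ?C \<and> z \<otimes>\<^bsub>G\<^esub> x \<in> ?C"
    have xG: "x \<in> carrier G" using subgroup.mem_carrier[OF C(1)] a by simp
    have "z \<otimes>\<^bsub>G\<^esub> x \<otimes>\<^bsub>G\<^esub> inv\<^bsub>G\<^esub> x \<in> ?C"
      using a subgroup.m_closed[OF C(1)] subgroup.m_inv_closed[OF C(1)] by simp
    then show False using xG C(2) by (simp add: m_assoc)
  qed
  with * show ?thesis by auto
qed

text \<open>
  The element \<open>x\<close> of \<open>K\<close> goes to its image in the quotient, twisted by \<open>c\<close> when \<open>x\<close> is outside the
  reference complement.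
\<close>

definition graph_map :: "'a set \<Rightarrow> 'a \<Rightarrow> _" where
  "graph_map K x = (if x \<in> complement (adjoin G z K) then p x else c \<otimes>\<^bsub>P\<^esub> p x)"

lemma graph_map_eqD:
  assumes x: "x \<in> carrier G" and y: "y \<in> carrier G" and eq: "graph_map K x = graph_map K y"
  shows "x \<in> complement (adjoin G z K) \<longleftrightarrow> y \<in> complement (adjoin G z K)"
    and "x = y \<or> x = z \<otimes>\<^bsub>G\<^esub> y"
proof -
  show same: "x \<in> complement (adjoin G z K) \<longleftrightarrow> y \<in> complement (adjoin G z K)"
    using eq c_p_neq[OF x y] c_p_neq[OF y x] by (simp add: graph_map_def split: if_splits)
  show "x = y \<or> x = z \<otimes>\<^bsub>G\<^esub> y"
    using eq same p_eq_iff[OF x y] c_p_eq_iff[OF x y] by (simp add: graph_map_def split: if_splits)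
qed

definition replace :: "'a set \<Rightarrow> _ set" where
  "replace K = (if z \<in> K then adjoin P c (p ` K) else graph_map K ` K)"

text \<open>
  A left inverse of \<open>replace\<close>: the set \<open>L\<close> recovers \<open>K \<union> z K\<close>, the element \<open>c\<close> tells whether \<open>z\<close> is in
  \<open>K\<close>, and if not, of the two elements \<open>x\<close> and \<open>z x\<close> only the one in \<open>K\<close> has its image in the graph.
\<close>

definition restore :: "_ set \<Rightarrow> 'a set" where
  "restore S = (let L = {x \<in> carrier G. p x \<in> S \<or> c \<otimes>\<^bsub>P\<^esub> p x \<in> S}
     in if c \<in> S then L
        else {x \<in> L. (if x \<in> complement L then p x else c \<otimes>\<^bsub>P\<^esub> p x) \<in> S})"

lemma replaceE:
  assumes "s \<in> replace K"
  obtains y where "y \<in> K" "s = p y \<or> s = c \<otimes>\<^bsub>P\<^esub> p y"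
proof (cases "z \<in> K")
  case True
  then show thesis using assms that by (auto simp: replace_def adjoin_def)
next
  case False
  then obtain y where "y \<in> K" "s = graph_map K y" using assms by (auto simp: replace_def)
  then show thesis using that[of y] by (simp add: graph_map_def split: if_splits)
qed

lemma replaceI: "y \<in> K \<Longrightarrow> p y \<in> replace K \<or> c \<otimes>\<^bsub>P\<^esub> p y \<in> replace K"
proof (cases "z \<in> K")
  case False
  assume "y \<in> K"
  then have "graph_map K y \<in> replace K" using False by (simp add: replace_def)
  then show ?thesis by (simp add: graph_map_def split: if_splits)
qed (simp add: replace_def adjoin_def)

lemma replace_preimage:
  assumes K: "subgroup K G"
  shows "{x \<in> carrier G. p x \<in> replace K \<or> c \<otimes>\<^bsub>P\<^esub> p x \<in> replace K} = adjoin G z K"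
proof (intro equalityI subsetI)
  note KG = subgroup.mem_carrier[OF K]
  {
    fix x assume "x \<in> {x \<in> carrier G. p x \<in> replace K \<or> c \<otimes>\<^bsub>P\<^esub> p x \<in> replace K}"
    then obtain s where x: "x \<in> carrier G" and s: "s \<in> replace K" "s = p x \<or> s = c \<otimes>\<^bsub>P\<^esub> p x" by auto
    obtain y where y: "y \<in> K" "s = p y \<or> s = c \<otimes>\<^bsub>P\<^esub> p y" using s(1) by (rule replaceE)
    have yG: "y \<in> carrier G" by (rule KG[OF y(1)])
    have "p x = p y \<or> c \<otimes>\<^bsub>P\<^esub> p x = c \<otimes>\<^bsub>P\<^esub> p y"
      using s(2) y(2) c_p_neq[OF x yG] c_p_neq[OF yG x] by auto
    then have "x = y \<or> x = z \<otimes>\<^bsub>G\<^esub> y"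
      using p_eq_iff[OF x yG] c_p_eq_iff[OF x yG] by simp
    then show "x \<in> adjoin G z K" using y(1) by (auto simp: adjoin_def)
  }
  fix x assume "x \<in> adjoin G z K"
  then obtain y where y: "y \<in> K" "x = y \<or> x = z \<otimes>\<^bsub>G\<^esub> y" by (auto simp: adjoin_def)
  have yG: "y \<in> carrier G" by (rule KG[OF y(1)])
  then have x: "x \<in> carrier G" using y(2) by auto
  have "p x = p y" using p_eq_iff[OF x yG] y(2) by simp
  then show "x \<in> {x \<in> carrier G. p x \<in> replace K \<or> c \<otimes>\<^bsub>P\<^esub> p x \<in> replace K}"
    using x replaceI[OF y(1)] by simp
qed

lemma c_in_replace:
  assumes K: "subgroup K G"
  shows "c \<in> replace K \<longleftrightarrow> z \<in> K"
proof
  have p1: "p \<one>\<^bsub>G\<^esub> = \<one>\<^bsub>P\<^esub>" using ker by simp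
  have oneK: "\<one>\<^bsub>G\<^esub> \<in> K" by (rule subgroup.one_closed[OF K])
  {
    assume "z \<in> K"
    moreover have "c \<otimes>\<^bsub>P\<^esub> p \<one>\<^bsub>G\<^esub> \<in> adjoin P c (p ` K)"
      using oneK by (simp add: adjoin_def)
    ultimately show "c \<in> replace K" using p1 by (simp add: replace_def)
  }
  assume cK: "c \<in> replace K"
  show "z \<in> K"
  proof (rule ccontr)
    assume z: "z \<notin> K"
    then obtain y where y: "y \<in> K" "c = graph_map K y" using cK by (auto simp: replace_def)
    have yG: "y \<in> carrier G" by (rule subgroup.mem_carrier[OF K y(1)])
    then have "c \<noteq> p y" using c_outside by auto
    then have nc: "y \<notin> complement (adjoin G z K)" and c: "c \<otimes>\<^bsub>P\<^esub> p y = c \<otimes>\<^bsub>P\<^esub> p \<one>\<^bsub>G\<^esub>"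
      using y(2) p1 by (simp_all add: graph_map_def split: if_splits)
    from c have "y = \<one>\<^bsub>G\<^esub> \<or> y = z" using c_p_eq_iff[OF yG one_closed] by simp
    then have "y = \<one>\<^bsub>G\<^esub>" using y(1) z by auto
    then show False using nc subgroup.one_closed[OF complement(1)[OF K z]] by simp
  qed
qed

lemma restore_replace:
  assumes K: "subgroup K G"
  shows "restore (replace K) = K"
proof -
  let ?L = "adjoin G z K"
  have rest: "restore (replace K) = (if z \<in> K then ?L else {x \<in> ?L. graph_map K x \<in> replace K})"
    unfolding restore_def Let_def replace_preimage[OF K] c_in_replace[OF K] graph_map_def ..
  have KL: "K \<subseteq> ?L" by (simp add: adjoin_def)
  show ?thesis
  proof (cases "z \<in> K")
    case True
    have "?L \<subseteq> K" by (rule adjoin_subset[OF K order.refl True])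
    then show ?thesis unfolding rest using True KL by simp
  next
    case False
    have rep: "replace K = graph_map K ` K" using False by (simp add: replace_def)
    have "{x \<in> ?L. graph_map K x \<in> replace K} = K"
    proof (intro equalityI subsetI)
      fix x assume "x \<in> K"
      then show "x \<in> {x \<in> ?L. graph_map K x \<in> replace K}" unfolding rep using KL by auto
    next
      fix x assume "x \<in> {x \<in> ?L. graph_map K x \<in> replace K}"
      then obtain y where xL: "x \<in> ?L" and y: "y \<in> K" "graph_map K x = graph_map K y"
        unfolding rep by auto
      have yG: "y \<in> carrier G" by (rule subgroup.mem_carrier[OF K y(1)])
      have x: "x \<in> carrier G" using xL subgroup.mem_carrier[OF K] by (auto simp: adjoin_def)
      have yL: "y \<in> ?L" using y(1) KL by auto
      have "x \<noteq> z \<otimes>\<^bsub>G\<^esub> y"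
        using graph_map_eqD(1)[OF x yG y(2)] shift_complement[OF K False yL] by auto
      then have "x = y" using graph_map_eqD(2)[OF x yG y(2)] by simp
      then show "x \<in> K" using y(1) by simp
    qed
    then show ?thesis unfolding rest using False by simp
  qed
qed

text \<open>
  A noncyclic \<open>K\<close> is larger than \<open>{1, z}\<close>, so the 2-group \<open>p K\<close> is nontrivial and has an involution. Together
  with \<open>c\<close> the image of \<open>K\<close> has two different involutions, which is impossible in a cyclic group.
\<close>

lemma replace_noncyclic_containing:
  assumes K: "subgroup K G" and nc: "\<not> cyclic_group (G\<lparr>carrier := K\<rparr>)" and zK: "z \<in> K"
  shows "replace K \<in> noncyclic_subgroups P"
proof -
  have KG: "K \<subseteq> carrier G" using K by (rule subgroup.subset)
  have rep: "replace K = adjoin P c (p ` K)" using zK by (simp add: replace_def)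
  have pK: "subgroup (p ` K) P" by (rule group_hom.subgroup_img_is_subgroup[OF p_group_hom K])
  have sub: "subgroup (replace K) P"
    unfolding rep
  proof (rule P.subgroup_adjoin[OF pK c_closed])
    fix h assume h: "h \<in> p ` K"
    have hP: "h \<in> carrier P" by (rule subgroup.mem_carrier[OF pK h])
    have "c \<otimes>\<^bsub>P\<^esub> h \<otimes>\<^bsub>P\<^esub> (c \<otimes>\<^bsub>P\<^esub> h) = h \<otimes>\<^bsub>P\<^esub> c \<otimes>\<^bsub>P\<^esub> (c \<otimes>\<^bsub>P\<^esub> h)"
      using c_comm[OF hP] by simp
    also have "\<dots> = h \<otimes>\<^bsub>P\<^esub> (c \<otimes>\<^bsub>P\<^esub> c) \<otimes>\<^bsub>P\<^esub> h"
      using hP by (simp only: P.m_assoc P.m_closed c_closed)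
    also have "\<dots> = h \<otimes>\<^bsub>P\<^esub> h" using hP c_square by simp
    finally show "c \<otimes>\<^bsub>P\<^esub> h \<otimes>\<^bsub>P\<^esub> (c \<otimes>\<^bsub>P\<^esub> h) \<in> p ` K"
      using subgroup.m_closed[OF pK h h] by simp
  qed
  have "\<exists>x\<in>K. x \<noteq> \<one>\<^bsub>G\<^esub> \<and> x \<noteq> z"
  proof (rule ccontr)
    assume "\<not> ?thesis"
    then have "K = {\<one>\<^bsub>G\<^esub>, z}" using zK subgroup.one_closed[OF K] by auto
    then have "K = range (\<lambda>k::nat. z [^]\<^bsub>G\<^esub> k)"
      using range_pow_involution[OF z_closed z_square] by simp
    then show False using nc zK unfolding cyclic_subgroup_iff[OF fin K] by metis
  qed
  then obtain x where x: "x \<in> K" "x \<noteq> \<one>\<^bsub>G\<^esub>" "x \<noteq> z" by auto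
  have xG: "x \<in> carrier G" using x KG by auto
  have p1: "p x \<noteq> \<one>\<^bsub>P\<^esub>" using ker[OF xG] x by simp
  have "x [^]\<^bsub>G\<^esub> ((2::nat) ^ n) = \<one>\<^bsub>G\<^esub>" using pow_order_eq_1[OF xG] order by simp
  then have "p x [^]\<^bsub>P\<^esub> ((2::nat) ^ n) = p \<one>\<^bsub>G\<^esub>"
    using group_hom.hom_nat_pow[OF p_group_hom xG, of "2 ^ n"] by simp
  then have "p x [^]\<^bsub>P\<^esub> ((2::nat) ^ n) = \<one>\<^bsub>P\<^esub>" using ker[OF one_closed] by simp
  then obtain k :: nat where k: "p x [^]\<^bsub>P\<^esub> k \<noteq> \<one>\<^bsub>P\<^esub>"
    "p x [^]\<^bsub>P\<^esub> k \<otimes>\<^bsub>P\<^esub> p x [^]\<^bsub>P\<^esub> k = \<one>\<^bsub>P\<^esub>"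
    by (rule P.involution_power[OF p_closed[OF xG] p1])
  have px: "p x \<in> p ` K" using x(1) by simp
  have pk: "p x [^]\<^bsub>P\<^esub> k \<in> p ` K"
  proof (induction k)
    case 0
    show ?case using subgroup.one_closed[OF pK] by simp
  next
    case (Suc k)
    show ?case using subgroup.m_closed[OF pK Suc px] by simp
  qed
  have "\<not> cyclic_group (P\<lparr>carrier := replace K\<rparr>)"
  proof
    assume cyc: "cyclic_group (P\<lparr>carrier := replace K\<rparr>)"
    have cK: "c \<in> replace K" using c_in_replace[OF K] zK by simp
    have pkK: "p x [^]\<^bsub>P\<^esub> k \<in> replace K" using pk unfolding rep by (simp add: adjoin_def)
    have "p \<one>\<^bsub>G\<^esub> = \<one>\<^bsub>P\<^esub>" using ker by simp
    then have c1: "c \<noteq> \<one>\<^bsub>P\<^esub>" using c_outside by (metis imageI one_closed)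
    have "c = p x [^]\<^bsub>P\<^esub> k"
      by (rule P.cyclic_subgroup_unique_involution[OF finP sub cyc cK c1 c_square pkK k])
    then show False using pk KG c_outside by auto
  qed
  then show ?thesis using sub by (simp add: noncyclic_subgroups_def)
qed

text \<open>
  The reference complement has index two in \<open>K \<union> z K\<close>, so a product lies in it exactly when both factors
  lie in the same coset.
\<close>

lemma graph_map_mult:
  assumes K: "subgroup K G" "z \<notin> K" and xy: "x \<in> K" "y \<in> K"
  shows "graph_map K (x \<otimes>\<^bsub>G\<^esub> y) = graph_map K x \<otimes>\<^bsub>P\<^esub> graph_map K y"
proof -
  let ?C = "complement (adjoin G z K)"
  note C = complement(1)[OF K]
  have G: "x \<in> carrier G" "y \<in> carrier G" using subgroup.mem_carrier[OF K(1)] xy by simp_all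
  have L: "x \<in> adjoin G z K" "y \<in> adjoin G z K" "x \<otimes>\<^bsub>G\<^esub> y \<in> adjoin G z K"
    using xy subgroup.m_closed[OF K(1) xy] by (simp_all add: adjoin_def)
  have zy: "z \<otimes>\<^bsub>G\<^esub> (x \<otimes>\<^bsub>G\<^esub> y) = x \<otimes>\<^bsub>G\<^esub> (z \<otimes>\<^bsub>G\<^esub> y)"
  proof -
    have "z \<otimes>\<^bsub>G\<^esub> (x \<otimes>\<^bsub>G\<^esub> y) = z \<otimes>\<^bsub>G\<^esub> x \<otimes>\<^bsub>G\<^esub> y" using G by (simp add: m_assoc)
    also have "\<dots> = x \<otimes>\<^bsub>G\<^esub> z \<otimes>\<^bsub>G\<^esub> y" using z_comm[OF G(1)] by simp
    finally show ?thesis using G by (simp add: m_assoc)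
  qed
  have cy: "p x \<otimes>\<^bsub>P\<^esub> (c \<otimes>\<^bsub>P\<^esub> p y) = c \<otimes>\<^bsub>P\<^esub> p (x \<otimes>\<^bsub>G\<^esub> y)"
  proof -
    have "p x \<otimes>\<^bsub>P\<^esub> (c \<otimes>\<^bsub>P\<^esub> p y) = p x \<otimes>\<^bsub>P\<^esub> c \<otimes>\<^bsub>P\<^esub> p y" using G by (simp add: P.m_assoc)
    also have "\<dots> = c \<otimes>\<^bsub>P\<^esub> p x \<otimes>\<^bsub>P\<^esub> p y" using c_comm[OF p_closed[OF G(1)]] by simp
    finally show ?thesis using G by (simp add: P.m_assoc p_mult)
  qed
  have cx: "c \<otimes>\<^bsub>P\<^esub> p x \<otimes>\<^bsub>P\<^esub> p y = c \<otimes>\<^bsub>P\<^esub> p (x \<otimes>\<^bsub>G\<^esub> y)"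
    using G by (simp add: P.m_assoc p_mult)
  have cc: "c \<otimes>\<^bsub>P\<^esub> p x \<otimes>\<^bsub>P\<^esub> (c \<otimes>\<^bsub>P\<^esub> p y) = p (x \<otimes>\<^bsub>G\<^esub> y)"
  proof -
    have "c \<otimes>\<^bsub>P\<^esub> p x \<otimes>\<^bsub>P\<^esub> (c \<otimes>\<^bsub>P\<^esub> p y) = c \<otimes>\<^bsub>P\<^esub> (c \<otimes>\<^bsub>P\<^esub> p (x \<otimes>\<^bsub>G\<^esub> y))"
      using G cy by (simp add: P.m_assoc)
    also have "\<dots> = c \<otimes>\<^bsub>P\<^esub> c \<otimes>\<^bsub>P\<^esub> p (x \<otimes>\<^bsub>G\<^esub> y)" using G by (simp add: P.m_assoc)
    finally show ?thesis using G c_square by simp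
  qed
  have shift: "z \<otimes>\<^bsub>G\<^esub> a \<in> ?C \<longleftrightarrow> a \<notin> ?C" if "a \<in> adjoin G z K" for a
    by (rule shift_complement[OF K that])
  have mc: "a \<otimes>\<^bsub>G\<^esub> b \<in> ?C" if "a \<in> ?C" "b \<in> ?C" for a b
    by (rule subgroup.m_closed[OF C that])
  have zx: "z \<otimes>\<^bsub>G\<^esub> (x \<otimes>\<^bsub>G\<^esub> y) = z \<otimes>\<^bsub>G\<^esub> x \<otimes>\<^bsub>G\<^esub> y" using G by (simp add: m_assoc)
  have zz: "z \<otimes>\<^bsub>G\<^esub> x \<otimes>\<^bsub>G\<^esub> (z \<otimes>\<^bsub>G\<^esub> y) = x \<otimes>\<^bsub>G\<^esub> y"
  proof -
    have "z \<otimes>\<^bsub>G\<^esub> x \<otimes>\<^bsub>G\<^esub> (z \<otimes>\<^bsub>G\<^esub> y) = z \<otimes>\<^bsub>G\<^esub> (z \<otimes>\<^bsub>G\<^esub> (x \<otimes>\<^bsub>G\<^esub> y))"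
      unfolding zy using G by (simp add: m_assoc)
    also have "\<dots> = z \<otimes>\<^bsub>G\<^esub> z \<otimes>\<^bsub>G\<^esub> (x \<otimes>\<^bsub>G\<^esub> y)" using G by (simp add: m_assoc)
    finally show ?thesis using G z_square by simp
  qed
  have "x \<otimes>\<^bsub>G\<^esub> y \<in> ?C \<longleftrightarrow> (x \<in> ?C \<longleftrightarrow> y \<in> ?C)"
    using mc[of x y] mc[of x "z \<otimes>\<^bsub>G\<^esub> y"] mc[of "z \<otimes>\<^bsub>G\<^esub> x" y] mc[of "z \<otimes>\<^bsub>G\<^esub> x" "z \<otimes>\<^bsub>G\<^esub> y"]
      shift[OF L(1)] shift[OF L(2)] shift[OF L(3)]
    unfolding zz zx[symmetric] zy[symmetric] by argo
  then show ?thesis using cx cy cc p_mult[OF G] by (simp add: graph_map_def)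
qed

lemma replace_noncyclic_avoiding:
  assumes K: "subgroup K G" and nc: "\<not> cyclic_group (G\<lparr>carrier := K\<rparr>)" and zK: "z \<notin> K"
  shows "replace K \<in> noncyclic_subgroups P"
proof -
  let ?f = "graph_map K"
  note KG = subgroup.mem_carrier[OF K]
  have rep: "replace K = ?f ` K" using zK by (simp add: replace_def)
  have f_closed: "?f x \<in> carrier P" if "x \<in> K" for x
    using KG[OF that] by (simp add: graph_map_def)
  have K_group: "group (G\<lparr>carrier := K\<rparr>)" by (rule subgroup.subgroup_is_group[OF K is_group])
  have f_hom: "?f \<in> hom (G\<lparr>carrier := K\<rparr>) P"
    using graph_map_mult[OF K zK] f_closed by (simp add: hom_def)
  have "group_hom (G\<lparr>carrier := K\<rparr>) P ?f"
    by (simp add: group_hom_def group_hom_axioms_def K_group P.is_group f_hom)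
  then have sub: "subgroup (replace K) P"
    using group_hom.img_is_subgroup[of "G\<lparr>carrier := K\<rparr>" P ?f] by (simp add: rep)
  have inj: "inj_on ?f K"
  proof (rule inj_onI)
    fix x y assume xy: "x \<in> K" "y \<in> K" "?f x = ?f y"
    have yL: "y \<in> adjoin G z K" using xy(2) by (simp add: adjoin_def)
    have "x \<noteq> z \<otimes>\<^bsub>G\<^esub> y"
      using graph_map_eqD(1)[OF KG[OF xy(1)] KG[OF xy(2)] xy(3)] shift_complement[OF K zK yL] by auto
    then show "x = y" using graph_map_eqD(2)[OF KG[OF xy(1)] KG[OF xy(2)] xy(3)] by simp
  qed
  have "?f \<in> iso (G\<lparr>carrier := K\<rparr>) (P\<lparr>carrier := replace K\<rparr>)"
    using graph_map_mult[OF K zK] inj by (simp add: iso_def hom_def bij_betw_def rep)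
  then have "G\<lparr>carrier := K\<rparr> \<cong> P\<lparr>carrier := replace K\<rparr>" by (rule is_isoI)
  then have "\<not> cyclic_group (P\<lparr>carrier := replace K\<rparr>)"
    using nc isomorphic_group_cyclicity[OF _ K_group subgroup.subgroup_is_group[OF sub P.is_group]] by simp
  then show ?thesis using sub by (simp add: noncyclic_subgroups_def)
qed

lemma delta_le: "delta G \<le> delta P"
  unfolding delta_def
proof (rule card_inj_on_le)
  show "inj_on replace (noncyclic_subgroups G)"
    by (rule inj_on_inverseI[of _ restore]) (simp add: restore_replace noncyclic_subgroups_def)
  show "replace ` noncyclic_subgroups G \<subseteq> noncyclic_subgroups P"
    using replace_noncyclic_containing replace_noncyclic_avoiding
    by (auto simp: noncyclic_subgroups_def)
  show "finite (noncyclic_subgroups P)"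
  proof (rule finite_subset)
    show "noncyclic_subgroups P \<subseteq> Pow (carrier P)"
      using subgroup.subset by (auto simp: noncyclic_subgroups_def)
  qed (use finP in simp)
qed

end

section \<open>Reduction to squares in a subgroup of order two\<close>

text \<open>
  The group \<open>G / {1, z} \<times> C\<^sub>2\<close> has the same order as \<open>G\<close>. Its structure is transported along a bijection
  to the carrier of \<open>G\<close>, so that the construction stays in one type and can be iterated.
\<close>

lemma (in central_involution) exists_central_replacement:
  fixes n :: nat
  assumes order: "order G = 2 ^ n"
  obtains P :: "'a monoid" and p c
  where "central_replacement G z P n p c" "order P = 2 ^ n"
    "carrier P = adjoin P c (p ` carrier G)"
proof -
  let ?Z = "{\<one>, z}" and ?C = "integer_mod_group 2"
  have nZ: "?Z \<lhd> G"
    unfolding normal_inv_iff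
  proof (intro conjI ballI)
    fix x h assume x: "x \<in> carrier G" and h: "h \<in> ?Z"
    have "x \<otimes> z \<otimes> inv x = z" using z_comm[OF x, symmetric] x by (simp add: m_assoc)
    then show "x \<otimes> h \<otimes> inv x \<in> ?Z" using h x by auto
  qed (rule subgroup_one_z)
  interpret Z: normal ?Z G by (rule nZ)
  let ?M = "G Mod ?Z"
  let ?Q = "?M \<times>\<times> ?C"
  interpret M: group ?M by (rule Z.factorgroup_is_group)
  interpret C: group ?C by simp
  interpret Q: group ?Q by (rule DirProd_group[OF M.is_group C.is_group])
  have carC: "carrier ?C = {0, 1}" by (auto simp: carrier_integer_mod_group)
  have "card (carrier ?M) * card ?Z = order G"
    using lagrange[OF subgroup_one_z] by (simp add: FactGroup_def)
  moreover have "card ?Z = 2" using z_neq_one by auto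
  ultimately have cardQ: "card (carrier ?Q) = card (carrier G)"
    by (simp add: card_cartesian_product carC order_def)
  have finQ: "finite (carrier ?Q)"
  proof (rule card_ge_0_finite)
    show "0 < card (carrier ?Q)" unfolding cardQ using order by (simp add: order_def)
  qed
  obtain f where f: "bij_betw f (carrier ?Q) (carrier G)"
    using finite_same_card_bij[OF finQ fin cardQ] by blast
  then have inj: "inj_on f (carrier ?Q)" and im: "f ` carrier ?Q = carrier G"
    by (simp_all add: bij_betw_def)
  define P where "P = image_group f ?Q"
  have carP: "carrier P = carrier G" unfolding P_def image_group_carrier by (rule im)
  have P: "group P" unfolding P_def by (rule Q.inj_imp_image_group_is_group[OF inj])
  have fiso: "f \<in> iso ?Q P" unfolding P_def by (rule inj_imp_image_group_iso[OF inj])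
  then have fhom: "f \<in> hom ?Q P" by (simp add: iso_def)
  interpret P: group P by (rule P)
  interpret f: group_hom ?Q P f using fhom by unfold_locales
  define i where "i = (\<lambda>x. (?Z #> x, 0::int))"
  define p where "p = (\<lambda>x. f (i x))"
  define q where "q = (?Z, 1::int)"
  define c where "c = f q"
  have modG: "?Z #> x \<in> carrier ?M" if "x \<in> carrier G" for x
    using that by (simp add: carrier_FactGroup)
  have iQ: "i x \<in> carrier ?Q" if "x \<in> carrier G" for x
    using modG[OF that] by (simp add: i_def carC)
  have oneM: "?Z \<in> carrier ?M" using M.one_closed by simp
  have qQ: "q \<in> carrier ?Q" using oneM by (simp add: q_def carC)
  have C0: "(0::int) \<otimes>\<^bsub>?C\<^esub> 0 = 0" "1 \<otimes>\<^bsub>?C\<^esub> (0::int) = 1" "0 \<otimes>\<^bsub>?C\<^esub> (1::int) = 1" "1 \<otimes>\<^bsub>?C\<^esub> (1::int) = 0"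
    by (simp_all add: integer_mod_group_def)
  have qM: "?Z \<otimes>\<^bsub>?M\<^esub> A = A" "A \<otimes>\<^bsub>?M\<^esub> ?Z = A" if "A \<in> carrier ?M" for A
    using M.l_one[OF that] M.r_one[OF that] by simp_all
  have q_comm: "q \<otimes>\<^bsub>?Q\<^esub> a = a \<otimes>\<^bsub>?Q\<^esub> q" if a: "a \<in> carrier ?Q" for a
  proof -
    obtain A e where a': "a = (A, e)" "A \<in> carrier ?M" "e \<in> carrier ?C" using a by auto
    show ?thesis using qM[OF a'(2)] a'(3) C0 by (auto simp: a'(1) q_def carC simp del: mult_FactGroup)
  qed
  have p_hom: "p \<in> hom G P"
  proof (rule homI)
    show "p x \<in> carrier P" if "x \<in> carrier G" for x unfolding p_def by (rule f.hom_closed[OF iQ[OF that]])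
    fix x y assume xy: "x \<in> carrier G" "y \<in> carrier G"
    have "i (x \<otimes> y) = i x \<otimes>\<^bsub>?Q\<^esub> i y"
      using Z.rcos_sum[OF xy] C0 by (simp add: i_def)
    then show "p (x \<otimes> y) = p x \<otimes>\<^bsub>P\<^esub> p y"
      unfolding p_def by (simp only: f.hom_mult[OF iQ[OF xy(1)] iQ[OF xy(2)]])
  qed
  have ker: "p x = \<one>\<^bsub>P\<^esub> \<longleftrightarrow> x = \<one> \<or> x = z" if x: "x \<in> carrier G" for x
  proof -
    have "p x = \<one>\<^bsub>P\<^esub> \<longleftrightarrow> f (i x) = f \<one>\<^bsub>?Q\<^esub>" unfolding p_def f.hom_one ..
    also have "\<dots> \<longleftrightarrow> i x = \<one>\<^bsub>?Q\<^esub>"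
      using inj_on_eq_iff[OF inj iQ[OF x] Q.one_closed] .
    also have "\<dots> \<longleftrightarrow> ?Z #> x = ?Z"
      by (simp add: i_def integer_mod_group_def)
    also have "\<dots> \<longleftrightarrow> x \<in> ?Z"
      using coset_join1[OF _ x subgroup_one_z] coset_join2[OF x subgroup_one_z]
        subgroup.subset[OF subgroup_one_z] by blast
    finally show ?thesis by simp
  qed
  have onto: "a = i x \<or> a = q \<otimes>\<^bsub>?Q\<^esub> i x"
    if "x \<in> carrier G" "a = (?Z #> x, e)" "e \<in> carrier ?C" for a x e
    using that qM[OF modG[OF that(1)]] C0 by (auto simp: i_def q_def carC simp del: mult_FactGroup)
  have carP2: "carrier P = adjoin P c (p ` carrier G)"
  proof (intro equalityI subsetI)
    fix y assume "y \<in> carrier P"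
    then obtain a where a: "a \<in> carrier ?Q" "y = f a" unfolding carP im[symmetric] by blast
    then obtain A e where Ae: "a = (A, e)" "A \<in> carrier ?M" "e \<in> carrier ?C" by auto
    then obtain x where x: "x \<in> carrier G" "A = ?Z #> x" unfolding carrier_FactGroup by blast
    have "a = i x \<or> a = q \<otimes>\<^bsub>?Q\<^esub> i x" using onto[OF x(1)] Ae x(2) by simp
    then have "y = p x \<or> y = c \<otimes>\<^bsub>P\<^esub> p x"
      using a(2) f.hom_mult[OF qQ iQ[OF x(1)]] by (auto simp: p_def c_def)
    then show "y \<in> adjoin P c (p ` carrier G)" using x(1) by (auto simp: adjoin_def)
  next
    fix y assume "y \<in> adjoin P c (p ` carrier G)"
    then show "y \<in> carrier P"
      using hom_in_carrier[OF p_hom] f.hom_closed[OF qQ] by (auto simp: adjoin_def c_def)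
  qed
  have "central_replacement G z P n p c"
  proof
    show "finite (carrier P)" unfolding carP by (rule fin)
    show "c \<in> center P"
      unfolding centralizer_def
    proof (intro CollectI conjI ballI)
      show "c \<in> carrier P" unfolding c_def by (rule f.hom_closed[OF qQ])
      fix y assume "y \<in> carrier P"
      then obtain a where a: "a \<in> carrier ?Q" "y = f a" unfolding carP im[symmetric] by blast
      show "c \<otimes>\<^bsub>P\<^esub> y = y \<otimes>\<^bsub>P\<^esub> c"
        unfolding a(2) c_def f.hom_mult[OF qQ a(1), symmetric] f.hom_mult[OF a(1) qQ, symmetric] q_comm[OF a(1)] ..
    qed
    have "q \<otimes>\<^bsub>?Q\<^esub> q = \<one>\<^bsub>?Q\<^esub>"
      using qM(1)[OF oneM] C0 by (simp add: q_def integer_mod_group_def)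
    then show "c \<otimes>\<^bsub>P\<^esub> c = \<one>\<^bsub>P\<^esub>"
      unfolding c_def f.hom_mult[OF qQ qQ, symmetric] by (simp only: f.hom_one)
    show "c \<notin> p ` carrier G"
    proof
      assume "c \<in> p ` carrier G"
      then obtain x where x: "x \<in> carrier G" "f q = f (i x)" by (auto simp: c_def p_def)
      then have "q = i x" using inj_on_eq_iff[OF inj qQ iQ[OF x(1)]] by simp
      then show False by (simp add: q_def i_def)
    qed
    show "order G = 2 ^ n" by (rule order)
    show "p \<in> hom G P" by (rule p_hom)
    show "p x = \<one>\<^bsub>P\<^esub> \<longleftrightarrow> x = \<one> \<or> x = z" if "x \<in> carrier G" for x by (rule ker[OF that])
  qed
  moreover have "order P = 2 ^ n" using order by (simp add: order_def carP)
  ultimately show thesis using that carP2 by blast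
qed

text \<open>
  For such \<open>N\<close> the quotient \<open>G / N\<close> is elementary abelian. The order of \<open>N\<close> measures how far \<open>G\<close> is from
  being elementary abelian, and it decreases in each replacement step.
\<close>

definition normal_with_squares :: "('a, 'b) monoid_scheme \<Rightarrow> 'a set \<Rightarrow> bool" where
  "normal_with_squares G N \<longleftrightarrow> N \<lhd> G \<and> (\<forall>x\<in>carrier G. x \<otimes>\<^bsub>G\<^esub> x \<in> N)"

lemma (in central_replacement) normal_with_squares_image:
  assumes N: "normal_with_squares G N" and z: "z \<in> N"
    and car: "carrier P = adjoin P c (p ` carrier G)"
  shows "normal_with_squares P (p ` N)" "card (p ` N) < card N"
proof -
  have Ns: "subgroup N G" and Nc: "\<And>x h. x \<in> carrier G \<Longrightarrow> h \<in> N \<Longrightarrow> x \<otimes>\<^bsub>G\<^esub> h \<otimes>\<^bsub>G\<^esub> inv\<^bsub>G\<^esub> x \<in> N"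
    and Nq: "\<And>x. x \<in> carrier G \<Longrightarrow> x \<otimes>\<^bsub>G\<^esub> x \<in> N"
    using N unfolding normal_with_squares_def normal_inv_iff by simp_all
  note NG = subgroup.mem_carrier[OF Ns]
  have cases: "\<exists>x\<in>carrier G. y = p x \<or> y = p x \<otimes>\<^bsub>P\<^esub> c" if "y \<in> carrier P" for y
    using that car c_comm by (auto simp: adjoin_def)
  have conj: "y \<otimes>\<^bsub>P\<^esub> p h \<otimes>\<^bsub>P\<^esub> inv\<^bsub>P\<^esub> y \<in> p ` N" if y: "y \<in> carrier P" and h: "h \<in> N" for y h
  proof -
    obtain x where x: "x \<in> carrier G" "y = p x \<or> y = p x \<otimes>\<^bsub>P\<^esub> c" using cases[OF y] by auto
    have ph: "p h \<in> carrier P" using NG[OF h] by simp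
    have "p x \<otimes>\<^bsub>P\<^esub> c \<otimes>\<^bsub>P\<^esub> p h \<otimes>\<^bsub>P\<^esub> inv\<^bsub>P\<^esub> (p x \<otimes>\<^bsub>P\<^esub> c) = p x \<otimes>\<^bsub>P\<^esub> p h \<otimes>\<^bsub>P\<^esub> inv\<^bsub>P\<^esub> p x"
    proof -
      have "p x \<otimes>\<^bsub>P\<^esub> c \<otimes>\<^bsub>P\<^esub> p h \<otimes>\<^bsub>P\<^esub> inv\<^bsub>P\<^esub> (p x \<otimes>\<^bsub>P\<^esub> c) =
          p x \<otimes>\<^bsub>P\<^esub> (c \<otimes>\<^bsub>P\<^esub> p h) \<otimes>\<^bsub>P\<^esub> (inv\<^bsub>P\<^esub> c \<otimes>\<^bsub>P\<^esub> inv\<^bsub>P\<^esub> p x)"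
        using x(1) ph by (simp add: P.m_assoc P.inv_mult_group)
      also have "\<dots> = p x \<otimes>\<^bsub>P\<^esub> (p h \<otimes>\<^bsub>P\<^esub> c) \<otimes>\<^bsub>P\<^esub> (inv\<^bsub>P\<^esub> c \<otimes>\<^bsub>P\<^esub> inv\<^bsub>P\<^esub> p x)"
        unfolding c_comm[OF ph] ..
      also have "\<dots> = p x \<otimes>\<^bsub>P\<^esub> p h \<otimes>\<^bsub>P\<^esub> (c \<otimes>\<^bsub>P\<^esub> inv\<^bsub>P\<^esub> c) \<otimes>\<^bsub>P\<^esub> inv\<^bsub>P\<^esub> p x"
        using x(1) ph by (simp only: P.m_assoc P.m_closed P.inv_closed c_closed p_closed)
      finally show ?thesis using x(1) ph by simp
    qed
    then have "y \<otimes>\<^bsub>P\<^esub> p h \<otimes>\<^bsub>P\<^esub> inv\<^bsub>P\<^esub> y = p x \<otimes>\<^bsub>P\<^esub> p h \<otimes>\<^bsub>P\<^esub> inv\<^bsub>P\<^esub> p x" using x(2) by auto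
    also have "\<dots> = p (x \<otimes>\<^bsub>G\<^esub> h \<otimes>\<^bsub>G\<^esub> inv\<^bsub>G\<^esub> x)"
      using x(1) NG[OF h] by (simp add: p_mult group_hom.hom_inv[OF p_group_hom])
    finally show ?thesis using Nc[OF x(1) h] by simp
  qed
  have square: "y \<otimes>\<^bsub>P\<^esub> y \<in> p ` N" if y: "y \<in> carrier P" for y
  proof -
    obtain x where x: "x \<in> carrier G" "y = p x \<or> y = p x \<otimes>\<^bsub>P\<^esub> c" using cases[OF y] by auto
    have px: "p x \<in> carrier P" using x by simp
    have "p x \<otimes>\<^bsub>P\<^esub> c \<otimes>\<^bsub>P\<^esub> (p x \<otimes>\<^bsub>P\<^esub> c) = p x \<otimes>\<^bsub>P\<^esub> c \<otimes>\<^bsub>P\<^esub> (c \<otimes>\<^bsub>P\<^esub> p x)"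
      unfolding c_comm[OF px] ..
    also have "\<dots> = p x \<otimes>\<^bsub>P\<^esub> (c \<otimes>\<^bsub>P\<^esub> c) \<otimes>\<^bsub>P\<^esub> p x"
      using px by (simp only: P.m_assoc P.m_closed c_closed)
    also have "\<dots> = p x \<otimes>\<^bsub>P\<^esub> p x" using px c_square by simp
    finally have "y \<otimes>\<^bsub>P\<^esub> y = p x \<otimes>\<^bsub>P\<^esub> p x" using x(2) by auto
    also have "\<dots> = p (x \<otimes>\<^bsub>G\<^esub> x)" using x(1) by (simp add: p_mult)
    finally show ?thesis using Nq[OF x(1)] by simp
  qed
  show "normal_with_squares P (p ` N)"
    unfolding normal_with_squares_def P.normal_inv_iff
    using conj square group_hom.subgroup_img_is_subgroup[OF p_group_hom Ns] by auto
  have finN: "finite N" using subgroup.subset[OF Ns] fin finite_subset by auto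
  have "p z = p \<one>\<^bsub>G\<^esub>" using ker[of z] ker[of "\<one>\<^bsub>G\<^esub>"] by simp
  moreover have "\<one>\<^bsub>G\<^esub> \<in> N - {z}" using subgroup.one_closed[OF Ns] z_neq_one by simp
  ultimately have "p ` N = p ` (N - {z})" by (auto simp: image_iff)
  then have "card (p ` N) \<le> card (N - {z})" using finN by (simp add: card_image_le)
  also have "\<dots> < card N" by (rule card_Diff1_less[OF finN z])
  finally show "card (p ` N) < card N" .
qed

text \<open>
  A central involution \<open>z\<close> is chosen inside \<open>N\<close>. If all squares are in \<open>{1, z}\<close> the comparison of layers
  applies. Otherwise some square survives in \<open>G / {1, z}\<close>, so the replacement is still not elementary
  abelian, and the image of \<open>N\<close> is smaller because \<open>z\<close> becomes trivial.
\<close>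

lemma bounded_or_replaced:
  fixes G :: "('a, 'b) monoid_scheme"
  assumes n: "n \<ge> 3" and G: "group G" "order G = 2 ^ n"
    and N: "normal_with_squares G N" and ne: "square_roots G \<one>\<^bsub>G\<^esub> \<noteq> carrier G"
  shows "delta G \<le> delta (dihedral_group 4 \<times>\<times> C2_power (n - 3)) \<or>
    (\<exists>(P :: 'a monoid) N'. group P \<and> order P = 2 ^ n \<and> normal_with_squares P N' \<and>
       square_roots P \<one>\<^bsub>P\<^esub> \<noteq> carrier P \<and> card N' < card N \<and> delta G \<le> delta P)"
proof -
  interpret group G by fact
  have fin: "finite (carrier G)" using G(2) order_gt_0_iff_finite by simp
  obtain x0 where x0: "x0 \<in> carrier G" "x0 \<otimes>\<^bsub>G\<^esub> x0 \<noteq> \<one>\<^bsub>G\<^esub>" using ne by (auto simp: square_roots_def)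
  have "x0 \<otimes>\<^bsub>G\<^esub> x0 \<in> N" using N x0(1) by (simp add: normal_with_squares_def)
  then have "N \<noteq> {\<one>\<^bsub>G\<^esub>}" using x0(2) by auto
  then obtain z where z: "z \<in> N" "z \<in> center G" "z \<noteq> \<one>\<^bsub>G\<^esub>" "z \<otimes>\<^bsub>G\<^esub> z = \<one>\<^bsub>G\<^esub>"
    using normal_subgroup_central_involution[OF G(2)] N unfolding normal_with_squares_def by metis
  interpret z: central_involution G z by unfold_locales (use fin z in auto)
  show ?thesis
  proof (cases "\<forall>x\<in>carrier G. x \<otimes>\<^bsub>G\<^esub> x \<in> {\<one>\<^bsub>G\<^esub>, z}")
    case True
    have Gz: "near_elementary_two_group G z n"
      by unfold_locales (use True G(2) n in auto)
    have "n - 3 + 3 = n" using n by simp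
    note D = extremal_dihedral[of "n - 3", unfolded this]
    show ?thesis by (rule disjI1) (rule delta_le_extremal[OF Gz ne D])
  next
    case False
    then obtain y where y: "y \<in> carrier G" "y \<otimes>\<^bsub>G\<^esub> y \<noteq> \<one>\<^bsub>G\<^esub>" "y \<otimes>\<^bsub>G\<^esub> y \<noteq> z" by auto
    obtain P :: "'a monoid" and p c where P: "central_replacement G z P n p c" "order P = 2 ^ n"
      "carrier P = adjoin P c (p ` carrier G)"
      by (rule z.exists_central_replacement[OF G(2)])
    interpret P: central_replacement G z P n p c by (rule P(1))
    have "p y \<otimes>\<^bsub>P\<^esub> p y \<noteq> \<one>\<^bsub>P\<^esub>"
      using P.p_mult[OF y(1) y(1)] P.ker[of "y \<otimes>\<^bsub>G\<^esub> y"] y by simp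
    moreover have "p y \<in> carrier P" using y(1) by simp
    ultimately have "square_roots P \<one>\<^bsub>P\<^esub> \<noteq> carrier P" by (auto simp: square_roots_def)
    then show ?thesis
      using P.normal_with_squares_image[OF N z(1) P(3)] P(2) P.delta_le P.P.is_group by blast
  qed
qed

lemma delta_le_dihedral:
  fixes G :: "'a monoid"
  assumes "n \<ge> 3" "group G" "order G = 2 ^ n"
    and "normal_with_squares G N" "square_roots G \<one>\<^bsub>G\<^esub> \<noteq> carrier G"
  shows "delta G \<le> delta (dihedral_group 4 \<times>\<times> C2_power (n - 3))"
  using assms(2-5)
proof (induction "card N" arbitrary: G N rule: less_induct)
  case less
  from bounded_or_replaced[OF assms(1) less.prems]
  consider "delta G \<le> delta (dihedral_group 4 \<times>\<times> C2_power (n - 3))"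
    | P :: "'a monoid" and N' where "group P" "order P = 2 ^ n" "normal_with_squares P N'"
        "square_roots P \<one>\<^bsub>P\<^esub> \<noteq> carrier P" "card N' < card N" "delta G \<le> delta P" by blast
  then show ?case
  proof cases
    case 2
    have "delta P \<le> delta (dihedral_group 4 \<times>\<times> C2_power (n - 3))"
      by (rule less.hyps[OF 2(5,1-4)])
    then show ?thesis using 2(6) by simp
  qed
qed

lemma (in group) elementary_abelian_if_all_involutions:
  assumes sq: "square_roots G \<one> = carrier G"
  shows "elementary_abelian G"
proof -
  have comm: "x \<otimes> y = y \<otimes> x" if "x \<in> carrier G" "y \<in> carrier G" for x y
    by (rule involutions_commute) (use that sq in simp_all)
  have "comm_group G" by (rule group_comm_groupI) (rule comm)
  moreover have "ord x = 2" if x: "x \<in> carrier G" "x \<noteq> \<one>" for x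
  proof -
    have "x \<in> square_roots G \<one>" using x sq by simp
    then have "x [^] (2::nat) = \<one>" using x by (simp add: square_roots_def numeral_2_eq_2)
    then have "ord x dvd 2" using pow_eq_id[OF x(1)] by simp
    then have "ord x = 1 \<or> ord x = 2" using prime_nat_iff two_is_prime_nat by blast
    then show ?thesis using ord_eq_1[OF x(1)] x(2) by simp
  qed
  ultimately show ?thesis unfolding elementary_abelian_def using two_is_prime_nat by blast
qed

theorem theorem1p3:
  fixes G :: "('a, 'b) monoid_scheme" and n :: nat
  assumes "n \<ge> 3"
    and "group G"
    and "order G = 2 ^ n"
    and "\<not> elementary_abelian G"
  shows "delta G \<le> delta (dihedral_group 4 \<times>\<times> C2_power (n - 3))"
proof -
  interpret group G by fact
  have "square_roots G \<one>\<^bsub>G\<^esub> \<noteq> carrier G"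
    using elementary_abelian_if_all_involutions assms(4) by blast
  moreover have "normal_with_squares G (carrier G)"
    by (simp add: normal_with_squares_def normal_inv_iff subgroup_self)
  ultimately have "delta G \<le> delta (dihedral_group 4 \<times>\<times> C2_power (n - 3)) \<or>
    (\<exists>(P :: 'a monoid) N'. group P \<and> order P = 2 ^ n \<and> normal_with_squares P N' \<and>
       square_roots P \<one>\<^bsub>P\<^esub> \<noteq> carrier P \<and> card N' < card (carrier G) \<and> delta G \<le> delta P)"
    using bounded_or_replaced[OF assms(1-3)] by blast
  then show ?thesis
  proof
    assume "\<exists>(P :: 'a monoid) N'. group P \<and> order P = 2 ^ n \<and> normal_with_squares P N' \<and>
       square_roots P \<one>\<^bsub>P\<^esub> \<noteq> carrier P \<and> card N' < card (carrier G) \<and> delta G \<le> delta P"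
    then obtain P :: "'a monoid" and N' where P: "group P" "order P = 2 ^ n"
      "normal_with_squares P N'" "square_roots P \<one>\<^bsub>P\<^esub> \<noteq> carrier P" "delta G \<le> delta P" by blast
    show ?thesis using delta_le_dihedral[OF assms(1) P(1-4)] P(5) by simp
  qed
qed

end
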